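(* Let $m\ge1$ and let $F^{(m)}(t;x,y)=\sum_{n\ge0}\sum_{[P,Q]} t^n x^{c(P)}y^{r(Q)}$, the inner sum over all intervals $[P,Q]$ (pairs $P\le Q$) of $\mathcal{T}_n^{(m)}$, where $c(P)$ is the number of contacts of $P$ and $r(Q)$ the initial rise of $Q$. Let $z,u,v$ be indeterminates and set $$t=z(1-z)^{m^2+2m},\quad x=\frac{1+u}{(1+zu)^{m+1}},\quad y=\frac{1+v}{(1+zv)^{m+1}}.$$ Then $F^{(m)}(t;x,y)$ becomes a formal power series in $z$ with coefficients in $\mathbb{Q}[u,v]$, this series is rational, and $$yF^{(m)}(t;x,y)=\frac{(1+u)(1+zu)(1+v)(1+zv)}{(u-v)(1-zuv)(1-z)^{m+2}}\left(\frac{1+u}{(1+zu)^{m+1}}-\frac{1+v}{(1+zv)^{m+1}}\right).$$ In particular, $yF^{(m)}(t;x,y)$ is symmetric in $x$ and $y$.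
   Context: A Dyck path of size $N$ is a path of $N$ up steps $(1,1)$ and $N$ down steps $(1,-1)$ from $(0,0)$ to $(2N,0)$ never going below the $x$-axis. An $m$-Dyck path of size $mn$ is a Dyck path of size $mn$ in which, for each $i\in\{0,\dots,n-1\}$, the up steps of ranks $mi+1,\dots,m(i+1)$ are consecutive. The Tamari lattice $\mathcal{T}_N$ is the set of Dyck paths of size $N$ ordered by the reflexive-transitive closure of the covering relation: $Q$ covers $P$ if there is in $P$ a down step $d$ immediately followed by an up step $u$ such that $Q$ is obtained from $P$ by swapping $d$ and the excursion of $u$ (the shortest factor of $P$ starting with $u$ that is a translated Dyck path). $\mathcal{T}_n^{(m)}$ is the set of $m$-Dyck paths of size $mn$ with the order induced from $\mathcal{T}_{mn}$ (equivalently, the $m$-Tamari lattice on $m$-ballot paths of size $n$). A contact of a Dyck path is a vertex on the $x$-axis (including both endpoints). The initial rise of an $m$-Dyck path $Q$ is the integer $k$ such that the initial run of up steps of $Q$ has length $mk$. The substitution defines $z,u,v$ uniquely as formal power series in $t$ with coefficients in $\mathbb{Q}$, $\mathbb{Q}[x]$, $\mathbb{Q}[y]$ respectively. *)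

theory Defs
  imports "HOL-Computational_Algebra.Computational_Algebra"
begin

section \<open>Dyck paths and the m-Tamari order\<close>

datatype step = U | D

definition height :: "step list \<Rightarrow> int" where
  "height w = int (count_list w U) - int (count_list w D)"

definition dyck :: "step list \<Rightarrow> bool" where
  "dyck w \<longleftrightarrow> height w = 0 \<and> (\<forall>k\<le>length w. 0 \<le> height (take k w))"

definition dyck_paths :: "nat \<Rightarrow> step list set" where
  "dyck_paths N = {w. dyck w \<and> count_list w U = N}"

definition up_positions :: "step list \<Rightarrow> nat list" where
  "up_positions w = filter (\<lambda>k. w ! k = U) [0..<length w]"

(* The up step of rank k (ranks start at 1) sits at position up_positions w ! (k - 1). *)
definition m_dyck_paths :: "nat \<Rightarrow> nat \<Rightarrow> step list set" where
  "m_dyck_paths m n = {w \<in> dyck_paths (m * n).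
     \<forall>i<n. \<forall>j<m. up_positions w ! (m * i + j) = up_positions w ! (m * i) + j}"

(* E is the excursion of the first step of w, where w starts with an up step: the shortest
   non-empty prefix of w that is a translated Dyck path. *)
definition excursion :: "step list \<Rightarrow> step list \<Rightarrow> bool" where
  "excursion w E \<longleftrightarrow> E \<noteq> [] \<and> hd E = U \<and> (\<exists>B. w = E @ B) \<and> dyck E \<and>
     (\<forall>k. 0 < k \<and> k < length E \<longrightarrow> \<not> dyck (take k E))"

definition tamari_covers :: "nat \<Rightarrow> step list \<Rightarrow> step list \<Rightarrow> bool" where
  "tamari_covers N P Q \<longleftrightarrow> P \<in> dyck_paths N \<and> Q \<in> dyck_paths N \<and>
     (\<exists>A E B. P = A @ [D] @ E @ B \<and> excursion (E @ B) E \<and> Q = A @ E @ [D] @ B)"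

definition tamari_le :: "nat \<Rightarrow> step list \<Rightarrow> step list \<Rightarrow> bool" where
  "tamari_le N = (tamari_covers N)\<^sup>*\<^sup>*"

definition m_tamari_intervals :: "nat \<Rightarrow> nat \<Rightarrow> (step list \<times> step list) set" where
  "m_tamari_intervals m n =
     {(P, Q). P \<in> m_dyck_paths m n \<and> Q \<in> m_dyck_paths m n \<and> tamari_le (m * n) P Q}"

lemma finite_dyck_paths: "finite (dyck_paths N)"
proof (rule finite_subset)
  have "length w = count_list w U + count_list w D" for w :: "step list"
  proof (induction w)
    case (Cons a w)
    then show ?case by (cases a) auto
  qed simp
  then show "dyck_paths N \<subseteq> {w. set w \<subseteq> {U, D} \<and> length w = 2 * N}"
    by (auto simp: dyck_paths_def dyck_def height_def intro: step.exhaust)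
  show "finite {w. set w \<subseteq> {U, D} \<and> length w = 2 * N}"
    by (rule finite_lists_length_eq) simp
qed

lemma finite_m_tamari_intervals: "finite (m_tamari_intervals m n)"
  by (rule finite_subset[of _ "dyck_paths (m * n) \<times> dyck_paths (m * n)"])
     (auto simp: m_tamari_intervals_def m_dyck_paths_def finite_dyck_paths)

definition contacts :: "step list \<Rightarrow> nat" where
  "contacts P = card {k. k \<le> length P \<and> height (take k P) = 0}"

definition initial_rise :: "nat \<Rightarrow> step list \<Rightarrow> nat" where
  "initial_rise m Q = (THE k. length (takeWhile (\<lambda>s. s = U) Q) = m * k)"

section \<open>The generating function and the substitution\<close>

(* An element of Q[a,b] is a rat poly poly: the inner variable is a and the outer one is b. *)

abbreviation var1 :: "rat poly poly" where "var1 \<equiv> [:[:0, 1:]:]"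
abbreviation var2 :: "rat poly poly" where "var2 \<equiv> [:0, 1:]"

(* A power series in t over Q[x,y], with x = var1 and y = var2. *)
definition tamari_gf :: "nat \<Rightarrow> rat poly poly fps" where
  "tamari_gf m = Abs_fps (\<lambda>n.
     \<Sum>(P, Q)\<in>m_tamari_intervals m n. var1 ^ contacts P * var2 ^ initial_rise m Q)"

definition symmetric_series :: "rat poly poly fps \<Rightarrow> bool" where
  "symmetric_series F \<longleftrightarrow>
     (\<forall>n i j. coeff (coeff (fps_nth F n) i) j = coeff (coeff (fps_nth F n) j) i)"

(* After the substitution all series live in Q(u,v)[[z]], with u = var1 and v = var2; the
   coefficient field is needed in order to divide by u - v. *)
type_synonym uv_series = "rat poly poly fract fps"

abbreviation uv_const :: "rat poly poly \<Rightarrow> uv_series" where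
  "uv_const p \<equiv> fps_const (to_fract p)"

definition eval_xy :: "rat poly poly \<Rightarrow> uv_series \<Rightarrow> uv_series \<Rightarrow> uv_series" where
  "eval_xy p x y = poly (map_poly (\<lambda>q. poly (map_poly (\<lambda>c. uv_const [:[:c:]:]) q) x) p) y"

(* F(t;x,y) becomes G: the sum over n of t^n F_n(x,y) converges to G, in the z-adic topology
   given by the metric on formal power series. *)
definition substitutes_to ::
    "rat poly poly fps \<Rightarrow> uv_series \<Rightarrow> uv_series \<Rightarrow> uv_series \<Rightarrow> uv_series \<Rightarrow> bool" where
  "substitutes_to F t x y G \<longleftrightarrow> (\<lambda>n. t ^ n * eval_xy (fps_nth F n) x y) sums G"

definition polynomial_coeffs :: "uv_series \<Rightarrow> bool" where
  "polynomial_coeffs G \<longleftrightarrow> (\<forall>k. fps_nth G k \<in> range to_fract)"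

(* G is a quotient of polynomials in z with coefficients in Q[u,v]. *)
definition rational_series :: "uv_series \<Rightarrow> bool" where
  "rational_series G \<longleftrightarrow> (\<exists>A B :: rat poly poly poly. B \<noteq> 0 \<and>
     G * fps_of_poly (map_poly to_fract B) = fps_of_poly (map_poly to_fract A))"

end

theory Submission
  imports Defs
begin

text \<open>Write \<open>Q = U Q1 D Q2\<close>. Then \<open>P \<le> Q\<close> in the Tamari order iff \<open>P = U l D r s\<close> with \<open>l r \<le> Q1\<close>
  and \<open>s \<le> Q2\<close>. Peeling off \<open>m\<close> first returns in this way yields the functional equation
  \<open>F(x,y) = x + x y t (F(x,1) \<Delta>)^m F(x,y)\<close> with \<open>\<Delta>S(x) = (S(x) - S(1)) / (x - 1)\<close>, which has only one
  solution, even after the substitution.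

  Put \<open>N(u) = (1 + u)(1 + zu)\<close> and \<open>A(u) = u / N(u)\<close>, so that
  \<open>A(u) - A(v) = (u - v)(1 - zuv) / (N(u) N(v))\<close> and the claim reads
  \<open>(1 - z)^(m+2) y F = (x - y) / (A(u) - A(v))\<close>. Up to a power of \<open>1 - z\<close> the operator \<open>F(x,1) \<Delta>\<close> is
  \<open>S \<mapsto> (S(u) - S(0)) / A(u)\<close>, the shift of coefficients of series in \<open>A(u)\<close>, and therefore commutes with
  \<open>X \<mapsto> (X(u) - X(v)) / (A(u) - A(v))\<close>. This reduces the functional equation to
  \<open>z X(u) + 1 / x + (1 - z)^(m+2) A(u)\<close> being independent of \<open>u\<close>, where \<open>X\<close> is the \<open>m\<close>-fold shift of \<open>x\<close>;
  and \<open>z x / A(u)^m + 1 / x + (1 - z)^(m+2) A(u)\<close> is a polynomial of degree \<open>m\<close> in \<open>1 / A(u)\<close>, because it is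
  invariant under \<open>u \<mapsto> 1 / (zu)\<close> and its poles at \<open>u = -1\<close> and \<open>u = -1/z\<close> cancel.\<close>

section \<open>Dyck words and the Tamari order\<close>

text \<open>\<open>None\<close> means that the path would go below the axis. Unlike the condition on
  all prefixes in \<open>dyck\<close>, this form supports structural recursion and composes along
  concatenation.\<close>

fun walk :: "nat \<Rightarrow> step list \<Rightarrow> nat option" where
  "walk h [] = Some h"
| "walk h (U # w) = walk (Suc h) w"
| "walk 0 (D # w) = None"
| "walk (Suc h) (D # w) = walk h w"

lemma height_simps [simp]:
  "height [] = 0" "height (U # w) = height w + 1" "height (D # w) = height w - 1"
  "height (v @ w) = height v + height w"
  by (simp_all add: height_def)

lemma all_le_Suc_iff: "(\<forall>j\<le>Suc n. P j) \<longleftrightarrow> P 0 \<and> (\<forall>j\<le>n. P (Suc j))"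
  by (metis Suc_le_mono le0 not0_implies_Suc)

lemma walk_eq_Some_iff:
  "walk h w = Some k \<longleftrightarrow>
     int k = int h + height w \<and> (\<forall>j\<le>length w. 0 \<le> int h + height (take j w))"
  by (induction h w rule: walk.induct) (auto simp: all_le_Suc_iff algebra_simps)

lemma dyck_iff_walk: "dyck w \<longleftrightarrow> walk 0 w = Some 0"
  by (auto simp: dyck_def walk_eq_Some_iff)

lemma walk_append: "walk h (v @ w) = Option.bind (walk h v) (\<lambda>k. walk k w)"
  by (induction h v rule: walk.induct) auto

lemma walk_add: "walk h w = Some k \<Longrightarrow> walk (h + j) w = Some (k + j)"
  by (auto simp: walk_eq_Some_iff)

lemma walk_height: "walk h w = Some k \<Longrightarrow> int k = int h + height w"
  by (simp add: walk_eq_Some_iff)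

lemma walk_appendE:
  assumes "walk h (v @ w) = Some k"
  obtains j where "walk h v = Some j" "walk j w = Some k"
  using assms by (cases "walk h v") (auto simp: walk_append)

lemma walk_dyck [simp]: "dyck w \<Longrightarrow> walk h w = Some h"
  using walk_add[of 0 w 0 h] by (simp add: dyck_iff_walk)

lemma walk_dyck_append [simp]: "dyck v \<Longrightarrow> walk h (v @ w) = walk h w"
  by (simp add: walk_append)

lemma dyck_Nil [simp]: "dyck []"
  by (simp add: dyck_iff_walk)

lemma dyck_append: "dyck v \<Longrightarrow> dyck (v @ w) \<longleftrightarrow> dyck w"
  by (simp add: dyck_iff_walk[of "v @ w"] dyck_iff_walk[of w])

lemma dyck_append_left: "dyck w \<Longrightarrow> dyck (v @ w) \<longleftrightarrow> dyck v"
  by (cases "walk 0 v") (auto simp: dyck_iff_walk[of "v @ w"] dyck_iff_walk[of v] walk_append)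

lemma dyck_U_D [simp]: "dyck v \<Longrightarrow> dyck (U # v @ D # w) \<longleftrightarrow> dyck w"
  by (simp add: dyck_iff_walk[of "U # _"] dyck_iff_walk[of w])

text \<open>A leading up step raises the level by one, so the rest must return first to level
  \<open>Suc h\<close> and then to \<open>h\<close>; two uses of the induction hypothesis supply
  these returns.\<close>

lemma walk_first_return:
  assumes "walk (Suc h) w = Some k" "k \<le> h"
  shows "\<exists>a b. w = a @ D # b \<and> dyck a \<and> walk h b = Some k"
  using assms
proof (induction "length w" arbitrary: h w rule: less_induct)
  case less
  show ?case
  proof (cases w)
    case Nil
    with less.prems show ?thesis by simp
  next
    case (Cons s w')
    show ?thesis
    proof (cases s)
      case D
      with less.prems Cons show ?thesis by (intro exI[of _ "[]"] exI[of _ w']) simp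
    next
      case U
      with less.prems Cons have "walk (Suc (Suc h)) w' = Some k" by simp
      with less.hyps[of w' "Suc h"] less.prems Cons obtain a b where
        ab: "w' = a @ D # b" "dyck a" "walk (Suc h) b = Some k" by auto
      with less.hyps[of b h] less.prems Cons obtain c d where
        "b = c @ D # d" "dyck c" "walk h d = Some k" by auto
      with ab Cons U show ?thesis
        by (intro exI[of _ "U # a @ D # c"] exI[of _ d]) simp
    qed
  qed
qed

lemma dyck_first_return:
  assumes "dyck w" "w \<noteq> []"
  obtains a b where "w = U # a @ D # b" "dyck a" "dyck b"
proof (cases w)
  case (Cons s w')
  then have "s = U" using assms by (cases s) (auto simp: dyck_iff_walk)
  with walk_first_return[of 0 w' 0] assms Cons that show ?thesis
    by (auto simp: dyck_iff_walk[of w] dyck_iff_walk)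
qed (use assms in simp)

lemma dyck_induct [consumes 1, case_names Nil UD]:
  assumes "dyck w" "Pr []"
    and "\<And>a b. dyck a \<Longrightarrow> dyck b \<Longrightarrow> Pr a \<Longrightarrow> Pr b \<Longrightarrow> Pr (U # a @ D # b)"
  shows "Pr w"
  using assms(1)
proof (induction "length w" arbitrary: w rule: less_induct)
  case less
  show ?case
  proof (cases "w = []")
    case False
    with less.prems obtain a b where "w = U # a @ D # b" "dyck a" "dyck b"
      by (rule dyck_first_return)
    with less.hyps[of a] less.hyps[of b] assms(3) show ?thesis by simp
  qed (use assms(2) in simp)
qed

text \<open>Otherwise the longer word is the shorter one followed by a word starting with
  \<open>D\<close>, and that remainder would have to be a Dyck path.\<close>

lemma first_return_unique:
  assumes "a @ D # b = a' @ D # b'" "dyck a" "dyck a'"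
  shows "a = a' \<and> b = b'"
proof -
  from assms(1) obtain us where
    "a = a' @ us \<and> us @ D # b = D # b' \<or> a @ us = a' \<and> D # b = us @ D # b'"
    by (auto simp: append_eq_append_conv2)
  with assms(2,3) show ?thesis
    by (cases us) (auto simp: dyck_append, auto simp: dyck_iff_walk)
qed

lemma dyck_height: "dyck w \<Longrightarrow> height w = 0"
  by (simp add: dyck_def)

lemma dyck_count_D: "dyck w \<Longrightarrow> count_list w D = count_list w U"
  by (simp add: dyck_def height_def)

lemma length_eq_counts: "length w = count_list w U + count_list w D"
proof (induction w)
  case (Cons s w)
  then show ?case by (cases s) auto
qed simp

lemma dyck_length: "dyck w \<Longrightarrow> length w = 2 * count_list w U"
  by (simp add: length_eq_counts dyck_count_D)

section \<open>Excursions and the covering relation\<close>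

definition prime_dyck :: "step list \<Rightarrow> bool" where
  "prime_dyck w \<longleftrightarrow> dyck w \<and> w \<noteq> [] \<and> (\<forall>k. 0 < k \<and> k < length w \<longrightarrow> \<not> dyck (take k w))"

lemma prime_dyck_U_D:
  assumes "dyck a"
  shows "prime_dyck (U # a @ [D])"
proof -
  have "\<not> dyck (take k (U # a @ [D]))" if k: "0 < k" "k < length (U # a @ [D])" for k
  proof -
    obtain j where j: "k = Suc j" "j \<le> length a" using k by (cases k) auto
    obtain p where "walk 0 (take j a) = Some p"
      using assms walk_appendE[of 0 "take j a" "drop j a" 0] by (auto simp: dyck_iff_walk)
    from walk_add[OF this, of 1] j show ?thesis by (auto simp: dyck_iff_walk)
  qed
  then show ?thesis using assms by (simp add: prime_dyck_def)
qed

lemma excursion_iff: "excursion w E \<longleftrightarrow> prime_dyck E \<and> (\<exists>B. w = E @ B)"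
  by (auto simp: excursion_def prime_dyck_def elim: dyck_first_return)

text \<open>Free of the size \<open>N\<close>, so that it passes to factors and contexts of a path.
  That the swap yields a Dyck path of the same size is \<open>dyck_swap\<close> and
  \<open>covers_count\<close>.\<close>

definition covers :: "step list \<Rightarrow> step list \<Rightarrow> bool" where
  "covers P Q \<longleftrightarrow> dyck P \<and> (\<exists>A E B. P = A @ D # E @ B \<and> prime_dyck E \<and> Q = A @ E @ D # B)"

abbreviation tle :: "step list \<Rightarrow> step list \<Rightarrow> bool" where
  "tle \<equiv> covers\<^sup>*\<^sup>*"

text \<open>The height \<open>j\<close> after \<open>A\<close> is positive in both cases, since
  \<open>E\<close> returns to its starting level and the step \<open>D\<close> must be possible from
  there.\<close>

lemma dyck_swap:
  assumes "dyck E"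
  shows "dyck (A @ D # E @ B) \<Longrightarrow> dyck (A @ E @ D # B)"
    and "dyck (A @ E @ D # B) \<Longrightarrow> dyck (A @ D # E @ B)"
proof -
  show "dyck (A @ D # E @ B) \<Longrightarrow> dyck (A @ E @ D # B)"
    using assms unfolding dyck_iff_walk[of "A @ _"]
    by (elim walk_appendE, rename_tac j, case_tac j) (auto simp: walk_append)
  show "dyck (A @ E @ D # B) \<Longrightarrow> dyck (A @ D # E @ B)"
    using assms unfolding dyck_iff_walk[of "A @ _"]
    by (elim walk_appendE, rename_tac j, case_tac j) (auto simp: walk_append)
qed

lemma covers_dyck: "covers P Q \<Longrightarrow> dyck P \<and> dyck Q"
  using dyck_swap(1) by (auto simp: covers_def prime_dyck_def)

lemma covers_count: "covers P Q \<Longrightarrow> count_list P s = count_list Q s"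
  by (auto simp: covers_def)

lemma covers_context: "covers P Q \<Longrightarrow> dyck (V @ P @ W) \<Longrightarrow> covers (V @ P @ W) (V @ Q @ W)"
  unfolding covers_def by (elim conjE exE, intro conjI) (simp, metis append.assoc append_Cons)

lemma tle_dyck: "tle P Q \<Longrightarrow> dyck P \<longleftrightarrow> dyck Q"
  by (induction rule: rtranclp_induct) (auto dest: covers_dyck)

lemma tle_count: "tle P Q \<Longrightarrow> count_list P s = count_list Q s"
  by (induction rule: rtranclp_induct) (auto dest: covers_count)

lemma tle_length: "tle P Q \<Longrightarrow> length P = length Q"
  by (simp add: length_eq_counts tle_count)

lemma tle_context: "tle P Q \<Longrightarrow> dyck (V @ P @ W) \<Longrightarrow> tle (V @ P @ W) (V @ Q @ W)"
proof (induction rule: rtranclp_induct)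
  case (step Q R)
  then have "tle (V @ P @ W) (V @ Q @ W)" by simp
  moreover from this step.prems have "dyck (V @ Q @ W)" using tle_dyck by blast
  ultimately show ?case using covers_context[OF step.hyps(2)] by (meson rtranclp.rtrancl_into_rtrancl)
qed simp

lemma tamari_le_iff:
  assumes "P \<in> dyck_paths N"
  shows "tamari_le N P Q \<longleftrightarrow> tle P Q"
proof
  have "tamari_covers N \<le> covers"
    unfolding le_fun_def tamari_covers_def covers_def excursion_iff dyck_paths_def by auto
  then show "tamari_le N P Q \<Longrightarrow> tle P Q"
    unfolding tamari_le_def by (blast dest: rtranclp_mono)
next
  have *: "tamari_covers N P Q" if "covers P Q" "count_list P U = N" for P Q
    using that covers_dyck[OF that(1)] covers_count[OF that(1), of U]
    unfolding tamari_covers_def covers_def excursion_iff dyck_paths_def by auto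
  assume "tle P Q"
  then have "tamari_le N P Q \<and> count_list Q U = N"
  proof (induction rule: rtranclp_induct)
    case base
    then show ?case using assms by (simp add: tamari_le_def dyck_paths_def)
  next
    case (step Q R)
    then show ?case using *[of Q R] covers_count[of Q R U]
      by (auto simp: tamari_le_def)
  qed
  then show "tamari_le N P Q" ..
qed

text \<open>\<open>E D\<close> cannot straddle the border: just before a step \<open>D\<close> in
  \<open>W\<close> the part of \<open>W\<close> read so far has positive height, whereas a suffix of
  the Dyck path \<open>E\<close> has height at most 0.\<close>

lemma factor_dyck_append:
  assumes "A @ E @ D # B = V @ W" "dyck E" "dyck V" "dyck W"
  shows "(\<exists>B'. V = A @ E @ D # B' \<and> B = B' @ W) \<or> (\<exists>A'. A = V @ A' \<and> W = A' @ E @ D # B)"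
proof -
  have "(A @ E @ [D]) @ B = V @ W" using assms(1) by simp
  then obtain C where "A @ E @ [D] = V @ C \<and> C @ B = W \<or> (A @ E @ [D]) @ C = V \<and> B = C @ W"
    unfolding append_eq_append_conv2[of "A @ E @ [D]" B V W] by blast
  then show ?thesis
  proof
    assume "(A @ E @ [D]) @ C = V \<and> B = C @ W"
    then show ?thesis by auto
  next
    assume C: "A @ E @ [D] = V @ C \<and> C @ B = W"
    show ?thesis
    proof (cases C rule: rev_cases)
      case Nil
      with C show ?thesis by (metis append.assoc append.right_neutral append_Cons append_Nil)
    next
      case (snoc C' s)
      with C have s: "s = D" and AE: "A @ E = V @ C'"
        by (metis append.assoc append1_eq_conv)+
      with C snoc have W: "W = C' @ D # B" by auto
      from assms(4) obtain j where j: "walk 0 C' = Some j" "walk j (D # B) = Some 0"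
        unfolding W dyck_iff_walk by (rule walk_appendE)
      then have "j \<noteq> 0" by (intro notI) simp
      with walk_height[OF j(1)] have pos: "height C' > 0" by simp
      from AE obtain us where "A = V @ us \<and> us @ E = C' \<or> A @ us = V \<and> E = us @ C'"
        unfolding append_eq_append_conv2[of A E V C'] by blast
      then show ?thesis
      proof
        assume "A = V @ us \<and> us @ E = C'"
        with W show ?thesis by auto
      next
        assume E: "A @ us = V \<and> E = us @ C'"
        then obtain p where "walk 0 us = Some p"
          using assms(2) walk_appendE[of 0 us C' 0] by (auto simp: dyck_iff_walk)
        from walk_height[OF this] have "height us \<ge> 0" by simp
        with E pos dyck_height[OF assms(2)] show ?thesis by simp
      qed
    qed
  qed
qed

text \<open>Either the \<open>D\<close> after \<open>E\<close> closes the arch or the whole factor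
  lies in \<open>V\<close>. If \<open>E\<close> started the arch, it would use it up by uniqueness
  of the first return, leaving nothing for its \<open>D\<close>.\<close>

lemma factor_dyck_U_D:
  assumes "A @ E @ D # B = U # V @ [D]" "dyck E" "E \<noteq> []" "dyck V"
  shows "(\<exists>A'. A = U # A' \<and> B = [] \<and> V = A' @ E) \<or>
         (\<exists>A' B'. A = U # A' \<and> B = B' @ [D] \<and> V = A' @ E @ D # B')"
proof (cases A)
  case Nil
  from assms(2,3) obtain a b where E: "E = U # a @ D # b" "dyck a" "dyck b"
    by (rule dyck_first_return)
  with assms(1) Nil have "a @ D # b @ D # B = V @ D # []" by simp
  with first_return_unique[of a "b @ D # B" V "[]"] E assms(4) show ?thesis by simp
next
  case (Cons s A')
  show ?thesis
  proof (cases B rule: rev_cases)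
    case Nil
    then show ?thesis using Cons assms by auto
  next
    case (snoc B' s')
    have "(A' @ E @ D # B') @ [s'] = V @ [D]" using assms(1) Cons snoc by simp
    then show ?thesis using Cons assms snoc by auto
  qed
qed

text \<open>Undoing a swap acts inside \<open>l\<close>, \<open>r\<close> or \<open>s\<close>, or
  moves the closing down step of the first arch left over the last excursion of \<open>l\<close>.
  That excursion then joins the front of \<open>r\<close>, and \<open>l @ r\<close> stays the
  same.\<close>

lemma covers_imp_first_return:
  assumes "covers P (U # l @ D # r @ s)" "dyck l" "dyck r" "dyck s"
  shows "\<exists>l' r' s'. P = U # l' @ D # r' @ s' \<and> dyck l' \<and> dyck r' \<and> dyck s' \<and>
           tle (l' @ r') (l @ r) \<and> tle s' s"
proof -
  from assms(1) obtain A E B where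
    P: "dyck P" "P = A @ D # E @ B" "prime_dyck E" "U # l @ D # r @ s = A @ E @ D # B"
    by (auto simp: covers_def)
  have E: "dyck E" "E \<noteq> []" using P(3) by (auto simp: prime_dyck_def)
  have "A @ E @ D # B = (U # l @ [D]) @ (r @ s)" using P(4) by simp
  from factor_dyck_append[OF this E(1)] assms(2-4)
  consider B' where "U # l @ [D] = A @ E @ D # B'" "B = B' @ r @ s"
    | A' where "A = U # l @ D # A'" "r @ s = A' @ E @ D # B"
    by (auto simp: dyck_append)
  then show ?thesis
  proof cases
    case 1
    from factor_dyck_U_D[OF 1(1)[symmetric] E assms(2)]
    consider A' where "A = U # A'" "B' = []" "l = A' @ E"
      | A' B'' where "A = U # A'" "B' = B'' @ [D]" "l = A' @ E @ D # B''" by blast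
    then show ?thesis
    proof cases
      case 1: 1
      with P \<open>B = B' @ r @ s\<close> have "P = U # A' @ D # (E @ r) @ s" by simp
      moreover have "dyck A'" using assms(2) E 1 by (simp add: dyck_append_left)
      ultimately show ?thesis using 1 E assms
        by (intro exI[of _ A'] exI[of _ "E @ r"] exI[of _ s]) (simp add: dyck_append)
    next
      case 2
      let ?l = "A' @ D # E @ B''"
      have l: "dyck ?l" using dyck_swap(2)[OF E(1)] assms(2) 2 by simp
      then have "covers ?l l" using 2 P(3) by (auto simp: covers_def)
      moreover have "dyck (?l @ r)" using dyck_append[OF l] assms(3) by blast
      ultimately have "tle (?l @ r) (l @ r)" using covers_context[of ?l l "[]" r] by simp
      moreover have "P = U # ?l @ D # r @ s" using P 1 2 by simp
      ultimately show ?thesis using l assms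
        by (intro exI[of _ ?l] exI[of _ r] exI[of _ s]) simp
    qed
  next
    case 2
    from factor_dyck_append[OF 2(2)[symmetric] E(1) assms(3,4)]
    consider B' where "r = A' @ E @ D # B'" "B = B' @ s"
      | A'' where "A' = r @ A''" "s = A'' @ E @ D # B" by blast
    then show ?thesis
    proof cases
      case 1: 1
      let ?r = "A' @ D # E @ B'"
      have r: "dyck ?r" using dyck_swap(2)[OF E(1)] assms(3) 1 by simp
      then have "covers ?r r" using 1 P(3) by (auto simp: covers_def)
      from covers_context[OF this, of l "[]"] have "tle (l @ ?r) (l @ r)"
        using r assms(2) by (auto simp: dyck_append)
      moreover have "P = U # l @ D # ?r @ s" using P 1 2 by simp
      ultimately show ?thesis using r assms
        by (intro exI[of _ l] exI[of _ ?r] exI[of _ s]) simp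
    next
      case 3: 2
      let ?s = "A'' @ D # E @ B"
      have s: "dyck ?s" using dyck_swap(2)[OF E(1)] assms(4) 3 by simp
      then have "covers ?s s" using 3 P(3) by (auto simp: covers_def)
      moreover have "P = U # l @ D # r @ ?s" using P 2 3 by simp
      ultimately show ?thesis using s assms
        by (intro exI[of _ l] exI[of _ r] exI[of _ ?s]) auto
    qed
  qed
qed

text \<open>The closing down step of the first arch jumps over the excursions of \<open>r\<close>
  one after the other; each jump is a covering.\<close>

lemma tle_absorb:
  assumes "dyck r" "dyck l" "dyck s"
  shows "tle (U # l @ D # r @ s) (U # l @ r @ D # s)"
  using assms
proof (induction r arbitrary: l rule: dyck_induct)
  case (UD a b)
  let ?E = "U # a @ [D]"
  have "covers (U # l @ D # ?E @ b @ s) (U # l @ ?E @ D # b @ s)"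
    unfolding covers_def
    by (intro conjI exI[of _ "U # l"] exI[of _ ?E] exI[of _ "b @ s"])
      (use UD in \<open>simp_all add: prime_dyck_U_D dyck_append\<close>)
  moreover have "tle (U # (l @ ?E) @ D # b @ s) (U # (l @ ?E) @ b @ D # s)"
    by (rule UD.IH) (use UD in \<open>simp_all add: dyck_append\<close>)
  ultimately show ?case by (simp add: converse_rtranclp_into_rtranclp)
qed simp

text \<open>Going down, the decomposition is inherited along each covering. Going up,
  \<open>r\<close> is first absorbed into the arch, then the inside of the arch and the rest are
  raised separately.\<close>

lemma tle_first_return_iff:
  assumes "dyck Q1" "dyck Q2"
  shows "tle P (U # Q1 @ D # Q2) \<longleftrightarrow>
    (\<exists>l r s. P = U # l @ D # r @ s \<and> dyck l \<and> dyck r \<and> dyck s \<and> tle (l @ r) Q1 \<and> tle s Q2)"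
    (is "_ \<longleftrightarrow> ?R P")
proof
  assume "tle P (U # Q1 @ D # Q2)"
  then show "?R P"
  proof (induction rule: converse_rtranclp_induct)
    case base
    show ?case
      by (rule exI[of _ Q1], rule exI[of _ "[]"], rule exI[of _ Q2]) (simp add: assms)
  next
    case (step P P')
    then obtain l r s where P': "P' = U # l @ D # r @ s" "dyck l" "dyck r" "dyck s"
      "tle (l @ r) Q1" "tle s Q2" by blast
    with covers_imp_first_return[of P l r s] step.hyps obtain l' r' s' where
      "P = U # l' @ D # r' @ s'" "dyck l'" "dyck r'" "dyck s'" "tle (l' @ r') (l @ r)" "tle s' s"
      by blast
    with P' show ?case
      by (intro exI[of _ l'] exI[of _ r'] exI[of _ s']) (auto intro: rtranclp_trans)
  qed
next
  assume "?R P"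
  then obtain l r s where P: "P = U # l @ D # r @ s" "dyck l" "dyck r" "dyck s"
      "tle (l @ r) Q1" "tle s Q2" by blast
  have "tle P (U # (l @ r) @ D # s)" using tle_absorb[of r l s] P by simp
  also have "tle (U # (l @ r) @ D # s) (U # Q1 @ D # s)"
    using tle_context[of "l @ r" Q1 "[U]" "D # s"] dyck_U_D[of "l @ r" s] P
    by (simp add: dyck_append)
  also have "tle (U # Q1 @ D # s) (U # Q1 @ D # Q2)"
    using tle_context[of s Q2 "U # Q1 @ [D]" "[]"] P assms by simp
  finally show "tle P (U # Q1 @ D # Q2)" .
qed

section \<open>Decomposition of intervals\<close>

lemma contacts_Nil [simp]: "contacts [] = 1"
  by (simp add: contacts_def)

lemma contacts_U_D:
  assumes "dyck a"
  shows "contacts (U # a @ D # b) = Suc (contacts b)"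
proof -
  let ?p = "U # a @ [D]"
  let ?S = "\<lambda>w. {k. k \<le> length w \<and> height (take k w) = 0}"
  have "?S (?p @ b) = insert 0 ((+) (length ?p) ` ?S b)"
  proof (intro set_eqI iffI)
    fix k assume k: "k \<in> ?S (?p @ b)"
    show "k \<in> insert 0 ((+) (length ?p) ` ?S b)"
    proof (cases "k < length ?p")
      case True
      have "k = 0"
      proof (rule ccontr)
        assume "k \<noteq> 0"
        then obtain j where j: "k = Suc j" "j \<le> length a" using True by (cases k) auto
        then have "0 \<le> height (take j a)" using assms by (auto simp: dyck_def)
        with j k show False by simp
      qed
      then show ?thesis by simp
    next
      case False
      then obtain i where "k = length ?p + i" using le_Suc_ex by (metis not_less)
      with k dyck_height[OF assms] have "i \<in> ?S b" by simp
      with \<open>k = _\<close> show ?thesis by blast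
    qed
  next
    fix k assume "k \<in> insert 0 ((+) (length ?p) ` ?S b)"
    then show "k \<in> ?S (?p @ b)" using dyck_height[OF assms] by auto
  qed
  moreover have "card ((+) (length ?p) ` ?S b) = card (?S b)"
    by (rule card_image) simp
  moreover have "finite ((+) (length ?p) ` ?S b)" "0 \<notin> (+) (length ?p) ` ?S b" by auto
  note card_insert_disjoint[OF this]
  ultimately have "card (?S (?p @ b)) = Suc (card (?S b))" by (simp only:)
  then show ?thesis by (simp add: contacts_def)
qed

lemma contacts_pos: "contacts w > 0"
proof -
  have "0 \<in> {k. k \<le> length w \<and> height (take k w) = 0}" by simp
  moreover have "finite {k. k \<le> length w \<and> height (take k w) = 0}" by simp
  ultimately show ?thesis unfolding contacts_def by (metis card_gt_0_iff empty_iff)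
qed

text \<open>The junction of \<open>r\<close> and \<open>s\<close> is a contact of both
  factors.\<close>

lemma contacts_append: "dyck r \<Longrightarrow> Suc (contacts (r @ s)) = contacts r + contacts s"
  by (induction r rule: dyck_induct) (simp_all add: contacts_U_D)

section \<open>Cuts of a Dyck path at its contacts\<close>

definition splits :: "step list \<Rightarrow> (step list \<times> step list) set" where
  "splits P = {(l, r). l @ r = P \<and> dyck l \<and> dyck r}"

lemma finite_splits [simp]: "finite (splits P)"
proof -
  have "splits P \<subseteq> (\<lambda>k. (take k P, drop k P)) ` {..length P}"
  proof clarify
    fix l r assume "(l, r) \<in> splits P"
    then have "P = l @ r" by (simp add: splits_def)
    then show "(l, r) \<in> (\<lambda>k. (take k P, drop k P)) ` {..length P}"
      by (intro image_eqI[of _ _ "length l"]) auto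
  qed
  then show ?thesis by (rule finite_subset) simp
qed

lemma splits_U_D:
  assumes "dyck a" "dyck b"
  shows "splits (U # a @ D # b) =
    insert ([], U # a @ D # b) ((\<lambda>(l, r). (U # a @ D # l, r)) ` splits b)" (is "_ = ?R")
proof (intro set_eqI iffI)
  fix p assume "p \<in> splits (U # a @ D # b)"
  then obtain l r where p: "p = (l, r)" "l @ r = U # a @ D # b" "dyck l" "dyck r"
    by (auto simp: splits_def)
  show "p \<in> ?R"
  proof (cases "l = []")
    case False
    with p(3) obtain c d where l: "l = U # c @ D # d" "dyck c" "dyck d" by (rule dyck_first_return)
    then have "c = a \<and> d @ r = b" using first_return_unique[of c "d @ r" a b] p assms by simp
    then show ?thesis using l p by (auto simp: splits_def image_iff)
  qed (use p in auto)
qed (use assms in \<open>auto simp: splits_def\<close>)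

text \<open>Cuts correspond to contacts of \<open>P\<close>; as the cut moves from right to left,
  the exponent takes each value from 0 upwards once.\<close>

lemma sum_splits:
  fixes x :: "'a :: comm_ring_1"
  assumes "dyck P"
  shows "(\<Sum>(l, r)\<in>splits P. x ^ (contacts r - 1)) = (\<Sum>i<contacts P. x ^ i)"
  using assms
proof (induction rule: dyck_induct)
  case Nil
  have "splits [] = {([], [])}" by (auto simp: splits_def)
  then show ?case by simp
next
  case (UD a b)
  have "([], U # a @ D # b) \<notin> (\<lambda>(l, r). (U # a @ D # l, r)) ` splits b" by auto
  moreover have "inj_on (\<lambda>(l, r). (U # a @ D # l, r)) (splits b)" by (auto simp: inj_on_def)
  ultimately show ?case using UD
    by (simp add: splits_U_D contacts_U_D sum.reindex case_prod_unfold o_def)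
qed

text \<open>For \<open>k > 0\<close> the cut \<open>l = []\<close> is excluded: it would separate the new up step \<open>U\<close> in
  \<open>U l D r s\<close> from the \<open>k\<close> up steps of its block.\<close>

definition splits_from :: "nat \<Rightarrow> step list \<Rightarrow> (step list \<times> step list) set" where
  "splits_from k P = {(l, r) \<in> splits P. k = 0 \<or> l \<noteq> []}"

lemma finite_splits_from [simp]: "finite (splits_from k P)"
  by (rule finite_subset[of _ "splits P"]) (auto simp: splits_from_def)

text \<open>Forbidding the cut \<open>l = []\<close> removes the largest exponent from the geometric
  sum.\<close>

lemma sum_splits_from:
  fixes x :: "'a :: comm_ring_1"
  assumes "dyck P"
  shows "(\<Sum>(l, r)\<in>splits_from k P. x ^ (contacts r - 1)) =
    (\<Sum>i<contacts P - of_bool (k > 0). x ^ i)"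
proof (cases "k = 0")
  case True
  then have "splits_from k P = splits P" by (auto simp: splits_from_def)
  with True sum_splits[OF assms] show ?thesis by simp
next
  case False
  then have *: "splits_from k P = splits P - {([], P)}" by (auto simp: splits_from_def splits_def)
  have "([], P) \<in> splits P" using assms by (simp add: splits_def)
  moreover obtain c where c: "contacts P = Suc c" using contacts_pos[of P] by (cases "contacts P") auto
  ultimately have "x ^ c + (\<Sum>(l, r)\<in>splits_from k P. x ^ (contacts r - 1)) = (\<Sum>i<Suc c. x ^ i)"
    using sum_splits[OF assms, of x]
      sum.remove[of "splits P" "([], P)" "\<lambda>(l, r). x ^ (contacts r - 1)"]
    unfolding * by (simp del: sum.lessThan_Suc)
  with c False show ?thesis by (simp add: add.commute)
qed

section \<open>Words whose up steps come in blocks of length m\<close>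

inductive blocks :: "nat \<Rightarrow> step list \<Rightarrow> bool" for m where
  blocks_Nil [intro, simp]: "blocks m []"
| blocks_D [intro]: "blocks m w \<Longrightarrow> blocks m (D # w)"
| blocks_U [intro]: "blocks m w \<Longrightarrow> blocks m (replicate m U @ w)"

lemma blocks_append: "blocks m v \<Longrightarrow> blocks m w \<Longrightarrow> blocks m (v @ w)"
  by (induction rule: blocks.induct) (auto intro: blocks_D blocks_U)

lemma replicate_U_append_eq:
  assumes "replicate k U @ v = a @ D # b"
  shows "\<exists>us. a = replicate k U @ us \<and> v = us @ D # b"
  using assms
proof (induction k arbitrary: a)
  case (Suc k)
  then show ?case by (cases a) auto
qed simp

lemma blocks_D_split: "blocks m (a @ D # b) \<Longrightarrow> blocks m a \<and> blocks m b"
proof (induction "a @ D # b" arbitrary: a rule: blocks.induct)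
  case (blocks_D w)
  then show ?case by (cases a) (auto intro: blocks.blocks_D)
next
  case (blocks_U w)
  then show ?case using replicate_U_append_eq[OF blocks_U(3)] by auto
qed simp

lemma count_list_replicate [simp]: "count_list (replicate n x) y = (if x = y then n else 0)"
  by (induction n) auto

lemma blocks_count_U: "blocks m w \<Longrightarrow> m dvd count_list w U"
  by (induction rule: blocks.induct) auto

lemma blocks_ups:
  "blocks m w \<Longrightarrow> m dvd length (takeWhile (\<lambda>s. s = U) w)"
  by (induction rule: blocks.induct) (auto simp: takeWhile_append)

text \<open>The words that are left of \<open>m\<close>-Dyck paths when \<open>m - k\<close> up steps of the first block have been
  peeled off.\<close>

definition rooted :: "nat \<Rightarrow> nat \<Rightarrow> step list set" where
  "rooted m k = {w. dyck w \<and> (\<exists>v. w = replicate k U @ v \<and> blocks m v)}"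

text \<open>The arch takes one up step of the first block and the other \<open>k\<close> open
  \<open>a\<close>; after the closing down step only whole blocks remain.\<close>

lemma rooted_U_D:
  assumes "dyck a" "dyck b"
  shows "U # a @ D # b \<in> rooted m (Suc k) \<longleftrightarrow> a \<in> rooted m k \<and> b \<in> rooted m 0"
proof
  assume "U # a @ D # b \<in> rooted m (Suc k)"
  then obtain v where v: "replicate k U @ v = a @ D # b" "blocks m v"
    by (auto simp: rooted_def)
  from replicate_U_append_eq[OF v(1)] obtain us where
    "a = replicate k U @ us" "v = us @ D # b" by blast
  with blocks_D_split[of m us b] v assms show "a \<in> rooted m k \<and> b \<in> rooted m 0"
    by (auto simp: rooted_def)
next
  assume "a \<in> rooted m k \<and> b \<in> rooted m 0"
  then obtain v where v: "a = replicate k U @ v" "blocks m v" "blocks m b"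
    by (auto simp: rooted_def)
  then have "blocks m (v @ D # b)" by (simp add: blocks_append blocks_D)
  with assms v(1) show "U # a @ D # b \<in> rooted m (Suc k)"
    by (auto simp: rooted_def simp flip: append_assoc intro!: exI[of _ "v @ D # b"])
qed

text \<open>A nonempty Dyck path ends with \<open>D\<close>, so a cut after \<open>l\<close> keeps
  the \<open>k\<close> initial up steps inside \<open>l\<close> and breaks no block. For
  \<open>k > 0\<close> an empty \<open>l\<close> has no room for them.\<close>

lemma rooted_append:
  assumes "dyck l" "dyck r"
  shows "l @ r \<in> rooted m k \<and> (k = 0 \<or> l \<noteq> []) \<longleftrightarrow> l \<in> rooted m k \<and> r \<in> rooted m 0"
proof
  assume *: "l @ r \<in> rooted m k \<and> (k = 0 \<or> l \<noteq> [])"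
  then obtain v where v: "l @ r = replicate k U @ v" "blocks m v" by (auto simp: rooted_def)
  show "l \<in> rooted m k \<and> r \<in> rooted m 0"
  proof (cases "l = []")
    case True
    with * show ?thesis by (auto simp: rooted_def)
  next
    case False
    then obtain l' s where l: "l = l' @ [s]" by (cases l rule: rev_cases) auto
    have "s = D"
    proof (rule ccontr)
      assume "s \<noteq> D"
      then have "s = U" by (cases s) auto
      with assms(1) l show False by (auto simp: dyck_iff_walk elim!: walk_appendE)
    qed
    with replicate_U_append_eq[of k v l' r] v l obtain us where
      "l' = replicate k U @ us" "v = us @ D # r" by auto
    moreover from this v have "blocks m (us @ [D])" "blocks m r"
      using blocks_D_split[of m us r] by (auto intro: blocks_append)
    ultimately show ?thesis using assms l \<open>s = D\<close> by (auto simp: rooted_def)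
  qed
next
  assume "l \<in> rooted m k \<and> r \<in> rooted m 0"
  with assms show "l @ r \<in> rooted m k \<and> (k = 0 \<or> l \<noteq> [])"
    by (cases k) (auto simp: rooted_def dyck_append intro: blocks_append)
qed

lemma rooted_full:
  assumes "m \<ge> 1"
  shows "w \<in> rooted m m \<longleftrightarrow> w \<in> rooted m 0 \<and> w \<noteq> []"
proof
  assume "w \<in> rooted m m"
  with assms show "w \<in> rooted m 0 \<and> w \<noteq> []" by (auto simp: rooted_def)
next
  assume w: "w \<in> rooted m 0 \<and> w \<noteq> []"
  then have "blocks m w" "dyck w" by (auto simp: rooted_def)
  then show "w \<in> rooted m m"
    by (cases rule: blocks.cases) (use w in \<open>auto simp: rooted_def dyck_iff_walk\<close>)
qed

lemma rooted_count_U: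
  assumes "w \<in> rooted m k"
  obtains n where "count_list w U = m * n + k"
  using assms blocks_count_U
  by (fastforce simp: rooted_def elim!: dvdE)

lemma up_positions_Nil [simp]: "up_positions [] = []"
  by (simp add: up_positions_def)

lemma up_positions_append:
  "up_positions (v @ w) = up_positions v @ map ((+) (length v)) (up_positions w)"
proof -
  have *: "[0..<length (v @ w)] = [0..<length v] @ map ((+) (length v)) [0..<length w]"
    by (intro nth_equalityI) (auto simp: nth_append)
  have "filter (\<lambda>k. (v @ w) ! k = U) [0..<length v] = filter (\<lambda>k. v ! k = U) [0..<length v]"
    by (rule filter_cong) (auto simp: nth_append)
  then show ?thesis unfolding up_positions_def * by (simp add: filter_map o_def)
qed

lemma length_up_positions: "length (up_positions w) = count_list w U"
proof (induction w)
  case (Cons s w)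
  have "up_positions (s # w) = up_positions [s] @ map Suc (up_positions w)"
    using up_positions_append[of "[s]" w] by (simp add: Suc_eq_plus1_left[symmetric] cong: map_cong)
  with Cons show ?case by (auto simp: up_positions_def)
qed simp

lemma up_positions_replicate: "up_positions (replicate m U) = [0..<m]"
  by (auto simp: up_positions_def intro: filter_True)

lemma blocks_replicate_U_iff:
  assumes "m \<ge> 1"
  shows "blocks m (replicate m U @ w) \<longleftrightarrow> blocks m w"
proof
  assume "blocks m (replicate m U @ w)"
  then show "blocks m w"
    by (cases rule: blocks.cases) (use assms in \<open>cases m; auto\<close>)+
qed auto

definition grouped_ups :: "nat \<Rightarrow> nat \<Rightarrow> step list \<Rightarrow> bool" where
  "grouped_ups m n w \<longleftrightarrow>
     (\<forall>i<n. \<forall>j<m. up_positions w ! (m * i + j) = up_positions w ! (m * i) + j)"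

lemma index_less: "i < n \<Longrightarrow> j < m \<Longrightarrow> m * i + j < m * (n :: nat)"
  by (metis add.commute less_imp_add_positive mult_Suc_right mult_le_mono2 nat_add_left_cancel_less
      not_less_eq_eq order_less_le_trans Suc_leI add_less_cancel_left)

lemma grouped_ups_D:
  assumes "count_list w U = m * n"
  shows "grouped_ups m n (D # w) \<longleftrightarrow> grouped_ups m n w"
proof -
  have "up_positions (D # w) = map Suc (up_positions w)"
    using up_positions_append[of "[D]" w] by (simp add: up_positions_def)
  moreover have "m * i + j < length (up_positions w)" if "i < n" "j < m" for i j
    using index_less[OF that] assms by (simp add: length_up_positions)
  moreover from this[of _ 0] have "m * i < length (up_positions w)" if "i < n" "j < m" for i j
    using that by fastforce
  ultimately show ?thesis unfolding grouped_ups_def by (auto cong: all_cong)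
qed

lemma grouped_ups_replicate_U:
  assumes "count_list w U = m * n"
  shows "grouped_ups m (Suc n) (replicate m U @ w) \<longleftrightarrow> grouped_ups m n w"
proof -
  let ?u = "up_positions (replicate m U @ w)"
  have u: "?u = [0..<m] @ map ((+) m) (up_positions w)"
    by (simp add: up_positions_append up_positions_replicate)
  have *: "?u ! (m * Suc i + j) = m + up_positions w ! (m * i + j)" if "i < n" "j < m" for i j
    using index_less[OF that] assms unfolding u
    by (simp add: nth_append length_up_positions add.assoc)
  from this[of _ 0] have "?u ! (m * Suc i) = m + up_positions w ! (m * i)"
    if "i < n" "j < m" for i j using that by fastforce
  with * have "(\<forall>j<m. ?u ! (m * Suc i + j) = ?u ! (m * Suc i) + j) \<longleftrightarrow>
      (\<forall>j<m. up_positions w ! (m * i + j) = up_positions w ! (m * i) + j)" if "i < n" for i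
    using that by (auto simp del: mult_Suc_right)
  moreover have "?u ! j = ?u ! 0 + j" if "j < m" for j
    using that unfolding u by (simp add: nth_append)
  then have "\<forall>j<m. ?u ! (m * 0 + j) = ?u ! (m * 0) + j"
    unfolding mult_0_right add_0_left by blast
  ultimately show ?thesis
    unfolding grouped_ups_def All_less_Suc2 by blast
qed

text \<open>Both conditions are stable under removal of a leading \<open>D\<close> or a leading full
  block. A word starting with \<open>U\<close> but not with \<open>m\<close> up steps fails both,
  since grouping would put the first \<open>m\<close> up steps at positions 0 to
  \<open>m - 1\<close>.\<close>

lemma blocks_iff_grouped_ups:
  assumes "m \<ge> 1" "count_list w U = m * n"
  shows "blocks m w \<longleftrightarrow> grouped_ups m n w"
  using assms(2)
proof (induction "length w" arbitrary: w n rule: less_induct)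
  case less
  show ?case
  proof (cases w)
    case Nil
    with less.prems assms(1) show ?thesis by (simp add: grouped_ups_def)
  next
    case (Cons s v)
    show ?thesis
    proof (cases s)
      case D
      have "blocks m (D # v) \<longleftrightarrow> blocks m v" using blocks_D_split[of m "[]" v] by auto
      with less Cons D show ?thesis by (simp add: grouped_ups_D)
    next
      case U
      then obtain n' where n: "n = Suc n'" using less.prems Cons by (cases n) auto
      show ?thesis
      proof (cases "\<exists>v. w = replicate m U @ v")
        case True
        then obtain v where v: "w = replicate m U @ v" by blast
        have "count_list v U = m * n'" "length v < length w"
          using less.prems v n assms(1) by simp_all
        with less.hyps[of v n'] v n show ?thesis
          by (simp add: grouped_ups_replicate_U blocks_replicate_U_iff[OF assms(1)])
      next
        case False
        have "\<not> blocks m w"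
        proof
          assume "blocks m w"
          then show False by (cases rule: blocks.cases) (use False Cons U in auto)
        qed
        moreover have "\<not> grouped_ups m n w"
        proof
          assume g: "grouped_ups m n w"
          have "up_positions w ! 0 = 0"
            using up_positions_append[of "[U]" v] Cons U by (simp add: up_positions_def)
          with g n have pos: "up_positions w ! j = j" if "j < m" for j
            using that unfolding grouped_ups_def by (metis add_0 mult_0_right zero_less_Suc)
          have U: "j < length w \<and> w ! j = U" if "j < m" for j
          proof -
            have "j < length (up_positions w)"
              using that less.prems n by (simp add: length_up_positions)
            then have "j \<in> set (up_positions w)" using pos[OF that] by (metis nth_mem)
            then show ?thesis by (auto simp: up_positions_def)
          qed
          then have "m \<le> length w" using assms(1) by (metis diff_Suc_less less_le_trans not_le less_irrefl zero_less_one)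
          with U have "take m w = replicate m U" by (intro nth_equalityI) auto
          then have "w = replicate m U @ drop m w" by (metis append_take_drop_id)
          with False show False by blast
        qed
        ultimately show ?thesis by simp
      qed
    qed
  qed
qed

lemma m_dyck_paths_eq:
  assumes "m \<ge> 1"
  shows "m_dyck_paths m n = {w \<in> rooted m 0. count_list w U = m * n}"
  using blocks_iff_grouped_ups[OF assms]
  by (auto simp: m_dyck_paths_def rooted_def dyck_paths_def grouped_ups_def)

text \<open>\<open>n\<close> counts the blocks besides the \<open>k\<close> up steps left of the
  first one; \<open>tle_count\<close> gives the same count for \<open>Q\<close>.\<close>

definition intervals :: "nat \<Rightarrow> nat \<Rightarrow> nat \<Rightarrow> (step list \<times> step list) set" where
  "intervals m k n = {(P, Q). P \<in> rooted m k \<and> Q \<in> rooted m k \<and>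
     count_list P U = m * n + k \<and> tle P Q}"

lemma m_tamari_intervals_eq:
  assumes "m \<ge> 1"
  shows "m_tamari_intervals m n = intervals m 0 n"
proof -
  have "tamari_le (m * n) P Q \<longleftrightarrow> tle P Q" if "P \<in> rooted m 0" "count_list P U = m * n" for P Q
    by (rule tamari_le_iff) (use that in \<open>simp add: dyck_paths_def rooted_def\<close>)
  then show ?thesis
    using tle_count[of _ _ U]
    by (auto simp: m_tamari_intervals_def m_dyck_paths_eq[OF assms] intervals_def)
qed

lemma intervals_dyck: "(P, Q) \<in> intervals m k n \<Longrightarrow> dyck P \<and> dyck Q"
  by (auto simp: intervals_def rooted_def)

lemma intervals_length: "(P, Q) \<in> intervals m k n \<Longrightarrow> length P = length Q"
  by (auto simp: intervals_def intro: tle_length)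

lemma intervals_count:
  assumes "(P, Q) \<in> intervals m k n"
  shows "count_list P U = m * n + k" "count_list Q U = m * n + k"
  using assms tle_count[of P Q U] by (auto simp: intervals_def)

lemma finite_intervals [simp]: "finite (intervals m k n)"
proof (rule finite_subset)
  show "intervals m k n \<subseteq> dyck_paths (m * n + k) \<times> dyck_paths (m * n + k)"
    by (auto simp: dyck_paths_def intervals_dyck intervals_count)
qed (simp add: finite_dyck_paths)

section \<open>The bijection behind the functional equation\<close>

abbreviation ups :: "step list \<Rightarrow> nat" where
  "ups w \<equiv> length (takeWhile (\<lambda>s. s = U) w)"

text \<open>\<open>(P1, Q1)\<close> is the interval attached to the inside of the first arch of the
  upper path, \<open>(l, r)\<close> a cut of \<open>P1\<close>, and \<open>(P2, Q2)\<close> the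
  interval after that arch. The size \<open>i\<close> of \<open>(P1, Q1)\<close> is recorded so that
  the domain is a disjoint union.\<close>

definition join :: "nat \<times> (step list \<times> step list) \<times> (step list \<times> step list) \<times> (step list \<times> step list)
    \<Rightarrow> step list \<times> step list" where
  "join = (\<lambda>(i, (P1, Q1), (l, r), (P2, Q2)). (U # l @ D # r @ P2, U # Q1 @ D # Q2))"

definition pieces :: "nat \<Rightarrow> nat \<Rightarrow> nat \<Rightarrow>
    (nat \<times> (step list \<times> step list) \<times> (step list \<times> step list) \<times> (step list \<times> step list)) set" where
  "pieces m k n = (SIGMA i:{..n}. SIGMA I1:intervals m k i.
     splits_from k (fst I1) \<times> intervals m 0 (n - i))"

lemma mem_pieces_iff:
  "(i, (P1, Q1), (l, r), (P2, Q2)) \<in> pieces m k n \<longleftrightarrow>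
     i \<le> n \<and> (P1, Q1) \<in> intervals m k i \<and> (l, r) \<in> splits_from k P1 \<and>
     (P2, Q2) \<in> intervals m 0 (n - i)"
  by (simp add: pieces_def)

text \<open>First returns recover \<open>l\<close>, \<open>Q1\<close> and \<open>Q2\<close>. The
  border between \<open>r\<close> and \<open>P2\<close> follows from lengths, as
  \<open>l @ r\<close> is as long as \<open>Q1\<close>; counting up steps then gives
  \<open>i\<close>.\<close>

lemma join_inj:
  assumes "m \<ge> 1"
  shows "inj_on join (pieces m k n)"
proof (rule inj_onI, clarsimp simp: mem_pieces_iff join_def, goal_cases)
  case (1 i P1 Q1 l r P2 Q2 i' P1' Q1' l' r' P2' Q2')
  then have d: "dyck l" "dyck l'" "dyck Q1" "dyck Q1'" "P1 = l @ r" "P1' = l' @ r'"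
    "length P1 = length Q1" "length P1' = length Q1'"
    "count_list P1 U = m * i + k" "count_list P1' U = m * i' + k"
    by (auto simp: splits_from_def splits_def intervals_dyck intervals_length intervals_count)
  have "l = l'" "r @ P2 = r' @ P2'"
    using first_return_unique[of l "r @ P2" l' "r' @ P2'"] d 1 by simp_all
  moreover have "Q1 = Q1'" "Q2 = Q2'"
    using first_return_unique[of Q1 Q2 Q1' Q2'] d 1 by simp_all
  moreover from calculation d have "length r = length r'" by simp
  ultimately show ?case using d assms by auto
qed

lemma join_image:
  "join ` pieces m k n = intervals m (Suc k) n"
proof (intro set_eqI iffI)
  fix I assume "I \<in> join ` pieces m k n"
  then obtain i P1 Q1 l r P2 Q2 where
    *: "i \<le> n" "(P1, Q1) \<in> intervals m k i" "(l, r) \<in> splits_from k P1"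
       "(P2, Q2) \<in> intervals m 0 (n - i)" "I = (U # l @ D # r @ P2, U # Q1 @ D # Q2)"
    by (auto simp: join_def mem_pieces_iff)
  have d: "P1 = l @ r" "dyck l" "dyck r" "dyck Q1" "dyck P2" "dyck Q2"
    using * by (auto simp: splits_from_def splits_def intervals_def rooted_def)
  have "l \<in> rooted m k \<and> r \<in> rooted m 0"
    using rooted_append[of l r m k] * d by (auto simp: splits_from_def intervals_def)
  moreover from this have "r @ P2 \<in> rooted m 0"
    using rooted_append[of r P2 m 0] * d by (auto simp: intervals_def)
  ultimately have "U # l @ D # r @ P2 \<in> rooted m (Suc k)"
    using d by (subst rooted_U_D) (auto simp: dyck_append)
  moreover have "U # Q1 @ D # Q2 \<in> rooted m (Suc k)"
    using * d by (subst rooted_U_D) (auto simp: intervals_def)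
  moreover have "tle (U # l @ D # r @ P2) (U # Q1 @ D # Q2)"
    using * d unfolding tle_first_return_iff[OF d(4,6)] by (auto simp: intervals_def)
  moreover have "m * i + m * (n - i) = m * n" using *(1) by (metis add_mult_distrib2 le_add_diff_inverse)
  then have "count_list (U # l @ D # r @ P2) U = m * n + Suc k"
    using * d by (auto simp: intervals_def)
  ultimately show "I \<in> intervals m (Suc k) n" using * by (simp add: intervals_def)
next
  fix I assume I: "I \<in> intervals m (Suc k) n"
  obtain P Q where PQ: "I = (P, Q)" by (cases I)
  have "Q \<noteq> []" "dyck Q" using I PQ by (auto simp: intervals_def rooted_def)
  then obtain Q1 Q2 where Q: "Q = U # Q1 @ D # Q2" "dyck Q1" "dyck Q2"
    by (metis dyck_first_return)
  with I PQ obtain l r s where P: "P = U # l @ D # r @ s" "dyck l" "dyck r" "dyck s"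
    "tle (l @ r) Q1" "tle s Q2"
    by (auto simp: intervals_def tle_first_return_iff)
  have "l \<in> rooted m k" "r @ s \<in> rooted m 0"
    using rooted_U_D[of l "r @ s" m k] I PQ P by (auto simp: intervals_def dyck_append)
  moreover from this have "r \<in> rooted m 0" "s \<in> rooted m 0"
    using rooted_append[of r s m 0] P by auto
  moreover have "Q1 \<in> rooted m k" "Q2 \<in> rooted m 0"
    using rooted_U_D[of Q1 Q2 m k] I PQ Q by (auto simp: intervals_def)
  ultimately have *: "l @ r \<in> rooted m k" "k = 0 \<or> l \<noteq> []" "s \<in> rooted m 0"
    "Q1 \<in> rooted m k" "Q2 \<in> rooted m 0"
    using rooted_append[of l r m k] P by auto
  obtain i where i: "count_list (l @ r) U = m * i + k" using rooted_count_U[OF *(1)] .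
  obtain j where j: "count_list s U = m * j" using rooted_count_U[OF *(3)] by auto
  have ij: "m * (i + j) = m * n"
    using i j I PQ P(1) by (auto simp: intervals_def algebra_simps)
  show "I \<in> join ` pieces m k n"
  proof (cases "m = 0")
    \<comment> \<open>For \<open>m = 0\<close> the number of up steps does not determine
      \<open>i\<close>; the value 0 is chosen.\<close>
    case True
    then show ?thesis using * i j P Q PQ
      by (intro image_eqI[of _ _ "(0, (l @ r, Q1), (l, r), (s, Q2))"])
        (auto simp: join_def mem_pieces_iff intervals_def splits_from_def splits_def)
  next
    case False
    with ij have "i \<le> n" "j = n - i" by auto
    then show ?thesis using * i j P Q PQ
      by (intro image_eqI[of _ _ "(i, (l @ r, Q1), (l, r), (s, Q2))"])
        (auto simp: join_def mem_pieces_iff intervals_def splits_from_def splits_def)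
  qed
qed

text \<open>Coefficient of \<open>t ^ n\<close> in \<open>(F(x,1) \<Delta>)^k F(x,y)\<close>. For \<open>k > 0\<close> the first contact does not count,
  as no cut is allowed there.\<close>

definition weight :: "nat \<Rightarrow> nat \<Rightarrow> 'a::comm_ring_1 \<Rightarrow> 'a \<Rightarrow> nat \<Rightarrow> 'a" where
  "weight m k x y n = (\<Sum>(P, Q)\<in>intervals m k n.
     x ^ (contacts P - of_bool (k > 0)) * y ^ ((ups Q - k) div m))"

text \<open>One application of the operator \<open>F(x,1) \<Delta>\<close>, cleared of the
  denominator \<open>x - 1\<close>. The cuts of \<open>P1\<close> contribute a geometric sum, hence
  the difference of weights at \<open>x\<close> and 1; \<open>(P2, Q2)\<close> does not affect the
  initial rise, hence its weight at \<open>y = 1\<close>.\<close>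

lemma weight_Suc:
  fixes x y :: "'a :: comm_ring_1"
  assumes "m \<ge> 1"
  shows "(x - 1) * weight m (Suc k) x y n =
    (\<Sum>i\<le>n. (weight m k x y i - weight m k 1 y i) * weight m 0 x 1 (n - i))"
proof -
  let ?g = "\<lambda>(P, Q). x ^ (contacts P - 1) * y ^ ((ups Q - Suc k) div m)"
  have bij: "bij_betw join (pieces m k n) (intervals m (Suc k) n)"
    using join_inj[OF assms] join_image by (simp add: bij_betw_def)
  \<comment> \<open>The contact at the origin is not counted for index \<open>Suc k\<close>, so only
    the contacts of \<open>r @ P2\<close> remain, and \<open>r\<close> and \<open>P2\<close> share
    one of them.\<close>
  have g: "?g (join (i, (P1, Q1), (l, r), (P2, Q2))) =
      y ^ ((ups Q1 - k) div m) * (x ^ (contacts r - 1) * x ^ contacts P2)"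
    if "(i, (P1, Q1), (l, r), (P2, Q2)) \<in> pieces m k n" for i P1 Q1 l r P2 Q2
  proof -
    have d: "dyck l" "dyck r"
      using that by (auto simp: mem_pieces_iff splits_from_def splits_def)
    have "Suc (contacts (r @ P2)) = contacts r + contacts P2" using d by (simp add: contacts_append)
    with contacts_pos[of r] have "contacts (r @ P2) = (contacts r - 1) + contacts P2" by simp
    moreover have "ups (Q1 @ D # Q2) = ups Q1" by (induction Q1) auto
    ultimately show ?thesis using d by (simp add: join_def contacts_U_D power_add mult_ac)
  qed
  have W: "(\<Sum>(P2, Q2)\<in>intervals m 0 j. c * (d * x ^ contacts P2)) = c * d * weight m 0 x 1 j" for j c d
    by (simp add: weight_def sum_distrib_left case_prod_unfold mult.assoc)
  have S: "(\<Sum>(l, r)\<in>splits_from k P1. x ^ (contacts r - 1)) =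
      (\<Sum>j<contacts P1 - of_bool (k > 0). x ^ j)" if "(P1, Q1) \<in> intervals m k i" for P1 Q1 i
    by (rule sum_splits_from) (use intervals_dyck[OF that] in simp)
  have geo: "(x - 1) * (c * (\<Sum>j<p. x ^ j)) = x ^ p * c - 1 ^ p * c" for c p
  proof -
    have "(x - 1) * (c * (\<Sum>j<p. x ^ j)) = ((x - 1) * (\<Sum>j<p. x ^ j)) * c" by (simp only: mult_ac)
    also have "\<dots> = (x ^ p - 1) * c" by (simp only: power_diff_1_eq)
    finally show ?thesis by (simp add: algebra_simps)
  qed
  have "weight m (Suc k) x y n = sum ?g (intervals m (Suc k) n)"
    by (simp add: weight_def)
  also have "\<dots> = (\<Sum>q\<in>pieces m k n. ?g (join q))"
    by (rule sum.reindex_bij_betw[OF bij, symmetric])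
  also have "\<dots> = (\<Sum>(i, (P1, Q1), (l, r), (P2, Q2))\<in>pieces m k n.
      y ^ ((ups Q1 - k) div m) * (x ^ (contacts r - 1) * x ^ contacts P2))"
    by (rule sum.cong[OF refl]) (use g in auto)
  also have "\<dots> = (\<Sum>i\<le>n. \<Sum>(P1, Q1)\<in>intervals m k i. \<Sum>(l, r)\<in>splits_from k P1.
      \<Sum>(P2, Q2)\<in>intervals m 0 (n - i).
      y ^ ((ups Q1 - k) div m) * (x ^ (contacts r - 1) * x ^ contacts P2))"
    unfolding pieces_def
    by (simp add: sum.Sigma sum.cartesian_product case_prod_unfold)
  also have "\<dots> = (\<Sum>i\<le>n. (\<Sum>(P1, Q1)\<in>intervals m k i. y ^ ((ups Q1 - k) div m) *
      (\<Sum>(l, r)\<in>splits_from k P1. x ^ (contacts r - 1))) * weight m 0 x 1 (n - i))"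
    by (simp only: W) (simp add: sum_distrib_left sum_distrib_right case_prod_unfold mult.assoc)
  also have "\<dots> = (\<Sum>i\<le>n. (\<Sum>(P1, Q1)\<in>intervals m k i. y ^ ((ups Q1 - k) div m) *
      (\<Sum>j<contacts P1 - of_bool (k > 0). x ^ j)) * weight m 0 x 1 (n - i))"
    by (intro sum.cong refl arg_cong2[of _ _ _ _ "(*)"], clarify, simp only: prod.case S)
  finally have *: "weight m (Suc k) x y n = \<dots>" .
  have **: "(x - 1) * (\<Sum>(P1, Q1)\<in>intervals m k i. y ^ ((ups Q1 - k) div m) *
      (\<Sum>j<contacts P1 - of_bool (k > 0). x ^ j)) = weight m k x y i - weight m k 1 y i" for i
    unfolding weight_def sum_subtractf[symmetric]
    by (subst sum_distrib_left, rule sum.cong[OF refl], clarify, simp only: prod.case geo)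
  show ?thesis
    unfolding * by (subst sum_distrib_left) (simp only: ** [symmetric] mult.assoc)
qed

text \<open>A nonempty path starts with a complete block, so its \<open>m\<close> up steps are all
  still to be peeled off. The factors \<open>x\<close> and \<open>y\<close> account for the contact
  at the origin and for this block in the initial rise.\<close>

lemma weight_0:
  fixes x y :: "'a :: comm_ring_1"
  assumes "m \<ge> 1"
  shows "weight m 0 x y 0 = x" "weight m 0 x y (Suc n) = x * y * weight m m x y n"
proof -
  have "intervals m 0 0 = {([], [])}"
  proof -
    have "w = []" if "dyck w" "count_list w U = 0" for w
      using dyck_length[OF that(1)] that(2) by simp
    then show ?thesis
      using tle_count[of _ _ U] by (auto simp: intervals_def rooted_def)
  qed
  then show "weight m 0 x y 0 = x" by (simp add: weight_def)
  have *: "intervals m 0 (Suc n) = intervals m m n"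
  proof -
    have "P \<noteq> []" "Q \<noteq> []" if "count_list P U = m + m * n" "tle P Q" for P Q
      using that assms tle_count[of P Q U] by auto
    then show ?thesis
      by (auto simp: intervals_def rooted_full[OF assms] add.commute)
  qed
  show "weight m 0 x y (Suc n) = x * y * weight m m x y n"
    unfolding weight_def sum_distrib_left *
  proof (rule sum.cong[OF refl], clarsimp, goal_cases)
    case (1 P Q)
    obtain c where c: "contacts P = Suc c" using contacts_pos[of P] by (cases "contacts P") auto
    from 1 obtain v where "Q = replicate m U @ v" by (auto simp: intervals_def rooted_def)
    then have "ups Q = m + ups v" by (simp add: takeWhile_append)
    then show ?case using c assms by (simp add: div_add_self1 mult_ac)
  qed
qed

text \<open>The description in \<open>initial_rise\<close> is proper: blocks make the initial run a
  multiple of \<open>m\<close>, and \<open>m\<close> is positive.\<close>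

lemma tamari_gf_nth:
  assumes "m \<ge> 1"
  shows "fps_nth (tamari_gf m) n = weight m 0 var1 var2 n"
proof -
  have "initial_rise m Q = ups Q div m" if "Q \<in> rooted m 0" for Q
  proof -
    have "m dvd ups Q" using that by (intro blocks_ups) (simp add: rooted_def)
    then have "ups Q = m * k \<longleftrightarrow> k = ups Q div m" for k using assms by auto
    then show ?thesis by (simp add: initial_rise_def)
  qed
  then show ?thesis unfolding tamari_gf_def m_tamari_intervals_eq[OF assms] weight_def
    by (auto intro!: sum.cong simp: intervals_def)
qed

section \<open>Ring morphisms\<close>

text \<open>Evaluation, specialisation and exchange of variables, and embedding of coefficients all
  have this form; identities proved once are transported along them.\<close>

locale ring_morphism =
  fixes h :: "'a :: comm_ring_1 \<Rightarrow> 'b :: comm_ring_1"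
  assumes hom_one [simp]: "h 1 = 1"
    and hom_add [simp]: "h (a + b) = h a + h b"
    and hom_mult [simp]: "h (a * b) = h a * h b"
begin

lemma hom_zero [simp]: "h 0 = 0"
  using hom_add[of 0 0] by simp

lemma hom_minus [simp]: "h (- a) = - h a"
  using hom_add[of a "- a"] by (simp add: eq_neg_iff_add_eq_0 add.commute)

lemma hom_diff [simp]: "h (a - b) = h a - h b"
  using hom_add[of a "- b"] by simp

lemma hom_power [simp]: "h (a ^ n) = h a ^ n"
  by (induction n) simp_all

lemma hom_sum [simp]: "h (sum f A) = (\<Sum>i\<in>A. h (f i))"
  by (induction A rule: infinite_finite_induct) simp_all

end

lemma ring_morphism_comp:
  assumes "ring_morphism f" "ring_morphism g"
  shows "ring_morphism (\<lambda>a. f (g a))"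
proof -
  interpret f: ring_morphism f by fact
  interpret g: ring_morphism g by fact
  show ?thesis by unfold_locales simp_all
qed

lemma ring_morphism_poly: "ring_morphism (\<lambda>p. poly p a)"
  by unfold_locales simp_all

lemma ring_morphism_map_poly:
  assumes "ring_morphism h"
  shows "ring_morphism (map_poly h)"
proof -
  interpret ring_morphism h by fact
  show ?thesis
    by unfold_locales (auto intro!: poly_eqI simp: coeff_map_poly coeff_mult)
qed

definition map_fps :: "('a \<Rightarrow> 'b) \<Rightarrow> 'a fps \<Rightarrow> 'b fps" where
  "map_fps h F = Abs_fps (\<lambda>n. h (fps_nth F n))"

lemma map_fps_nth [simp]: "fps_nth (map_fps h F) n = h (fps_nth F n)"
  by (simp add: map_fps_def)

lemma ring_morphism_map_fps:
  assumes "ring_morphism h"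
  shows "ring_morphism (map_fps h)"
proof -
  interpret ring_morphism h by fact
  show ?thesis by unfold_locales (auto intro!: fps_ext simp: fps_mult_nth)
qed

lemma map_fps_const [simp]: "h 0 = 0 \<Longrightarrow> map_fps h (fps_const c) = fps_const (h c)"
  by (auto intro!: fps_ext)

lemma map_fps_X [simp]: "h 0 = 0 \<Longrightarrow> h 1 = 1 \<Longrightarrow> map_fps h fps_X = fps_X"
  by (auto intro!: fps_ext simp: fps_X_def)

definition eval2 :: "(rat \<Rightarrow> 'a :: comm_ring_1) \<Rightarrow> 'a \<Rightarrow> 'a \<Rightarrow> rat poly poly \<Rightarrow> 'a" where
  "eval2 h a b p = poly (map_poly (\<lambda>q. poly (map_poly h q) a) p) b"

lemma ring_morphism_eval2:
  assumes "ring_morphism h"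
  shows "ring_morphism (eval2 h a b)"
  unfolding eval2_def
  by (rule ring_morphism_comp[OF ring_morphism_poly], rule ring_morphism_map_poly,
      rule ring_morphism_comp[OF ring_morphism_poly], rule ring_morphism_map_poly, rule assms)

lemma eval2_simps:
  assumes "ring_morphism h"
  shows "eval2 h a b [:[:c:]:] = h c" "eval2 h a b var1 = a" "eval2 h a b var2 = b"
proof -
  interpret ring_morphism h by fact
  show "eval2 h a b [:[:c:]:] = h c" "eval2 h a b var1 = a" "eval2 h a b var2 = b"
    by (simp_all add: eval2_def map_poly_pCons)
qed

lemma ring_morphism_poly_eqI:
  fixes f g :: "'a :: comm_ring_1 poly \<Rightarrow> 'b :: comm_ring_1"
  assumes "ring_morphism f" "ring_morphism g"
    and "\<And>c. f [:c:] = g [:c:]" "f [:0, 1:] = g [:0, 1:]"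
  shows "f p = g p"
proof -
  interpret f: ring_morphism f by fact
  interpret g: ring_morphism g by fact
  show ?thesis
  proof (induction p)
    case (pCons c p)
    have "pCons c p = [:c:] + [:0, 1:] * p" by simp
    then show ?case using pCons assms(3,4) by (simp only: f.hom_add f.hom_mult g.hom_add g.hom_mult)
  qed (simp only: f.hom_zero g.hom_zero)
qed

lemma ring_morphism_poly_const: "ring_morphism (\<lambda>c :: 'a :: comm_ring_1. [:c:])"
  by unfold_locales (simp_all add: one_pCons)

lemma ring_morphism_poly_poly_eqI:
  fixes f g :: "'a :: comm_ring_1 poly poly \<Rightarrow> 'b :: comm_ring_1"
  assumes "ring_morphism f" "ring_morphism g"
    and "\<And>c. f [:[:c:]:] = g [:[:c:]:]" "f [:[:0, 1:]:] = g [:[:0, 1:]:]" "f [:0, 1:] = g [:0, 1:]"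
  shows "f p = g p"
proof (rule ring_morphism_poly_eqI[OF assms(1,2)])
  fix q :: "'a poly"
  show "f [:q:] = g [:q:]"
    by (rule ring_morphism_poly_eqI[of "\<lambda>q. f [:q:]" "\<lambda>q. g [:q:]"])
      (use assms in \<open>auto intro: ring_morphism_comp[OF _ ring_morphism_poly_const]\<close>)
qed (rule assms(5))

section \<open>Substitution of a series without constant term\<close>

text \<open>If \<open>t\<close> has no constant term, \<open>t ^ n\<close> contributes only in
  orders at least \<open>n\<close>, so each coefficient is a finite sum.
  \<open>fps_subst_sums\<close> ties this algebraic form to convergence.\<close>

definition fps_subst :: "'a :: comm_ring_1 fps \<Rightarrow> (nat \<Rightarrow> 'a fps) \<Rightarrow> 'a fps" where
  "fps_subst t a = Abs_fps (\<lambda>k. fps_nth (\<Sum>n\<le>k. t ^ n * a n) k)"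

context
  fixes t :: "'a :: comm_ring_1 fps"
  assumes t0: "fps_nth t 0 = 0"
begin

lemma power_mult_nth_eq_0: "k < n \<Longrightarrow> fps_nth (t ^ n * f) k = 0"
  using startsby_zero_power_prefix[OF t0, of n] by (auto simp: fps_mult_nth intro!: sum.neutral)

lemma fps_subst_nth:
  assumes "k \<le> N"
  shows "fps_nth (fps_subst t a) k = fps_nth (\<Sum>n\<le>N. t ^ n * a n) k"
proof -
  have "(\<Sum>n\<le>k. fps_nth (t ^ n * a n) k) = (\<Sum>n\<le>N. fps_nth (t ^ n * a n) k)"
    by (rule sum.mono_neutral_left) (use assms power_mult_nth_eq_0 in auto)
  then show ?thesis by (simp add: fps_subst_def fps_sum_nth)
qed

lemma fps_subst_sums: "(\<lambda>n. t ^ n * a n) sums fps_subst t a"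
  unfolding sums_def_le
proof (rule tendsto_fpsI)
  fix k
  show "\<forall>\<^sub>F N in sequentially. fps_nth (\<Sum>n\<le>N. t ^ n * a n) k = fps_nth (fps_subst t a) k"
    using eventually_ge_at_top[of k] by eventually_elim (simp only: fps_subst_nth)
qed

lemma fps_subst_diff: "fps_subst t (\<lambda>n. a n - b n) = fps_subst t a - fps_subst t b"
  by (rule fps_ext) (simp add: fps_subst_def right_diff_distrib sum_subtractf)

lemma fps_subst_mult_left: "fps_subst t (\<lambda>n. c * a n) = c * fps_subst t a"
proof (rule fps_ext)
  fix k
  have "fps_nth (c * fps_subst t a) k = fps_nth (c * (\<Sum>n\<le>k. t ^ n * a n)) k"
    by (simp add: fps_mult_nth fps_subst_nth[of _ k])
  then show "fps_nth (fps_subst t (\<lambda>n. c * a n)) k = fps_nth (c * fps_subst t a) k"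
    by (simp add: fps_subst_def sum_distrib_left mult_ac)
qed

lemma fps_subst_Suc: "fps_subst t a = a 0 + t * fps_subst t (\<lambda>n. a (Suc n))"
proof (rule fps_ext)
  fix k
  have "fps_nth (fps_subst t a) k = fps_nth (\<Sum>n\<le>Suc k. t ^ n * a n) k"
    by (rule fps_subst_nth) simp
  also have "(\<Sum>n\<le>Suc k. t ^ n * a n) = a 0 + t * (\<Sum>n\<le>k. t ^ n * a (Suc n))"
    by (subst sum.atMost_Suc_shift) (simp add: sum_distrib_left mult_ac)
  also have "fps_nth \<dots> k = fps_nth (a 0 + t * fps_subst t (\<lambda>n. a (Suc n))) k"
    by (simp add: fps_mult_nth fps_subst_nth[of _ k])
  finally show "fps_nth (fps_subst t a) k = \<dots>" .
qed

text \<open>Cauchy product: the square of indices can be cut down to the triangle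
  \<open>i + j \<le> k\<close>, as all other terms start beyond order \<open>k\<close>.\<close>

lemma fps_subst_mult:
  "fps_subst t a * fps_subst t b = fps_subst t (\<lambda>n. \<Sum>i\<le>n. a i * b (n - i))"
proof (rule fps_ext)
  fix k
  let ?g = "\<lambda>i j. fps_nth (t ^ (i + j) * (a i * b j)) k"
  have g0: "?g i j = 0" if "\<not> i + j \<le> k" for i j
    using that by (intro power_mult_nth_eq_0) simp
  have "fps_nth (fps_subst t a * fps_subst t b) k =
      fps_nth ((\<Sum>n\<le>k. t ^ n * a n) * (\<Sum>n\<le>k. t ^ n * b n)) k"
    by (simp add: fps_mult_nth fps_subst_nth[of _ k])
  also have "\<dots> = (\<Sum>(i, j)\<in>{..k} \<times> {..k}. ?g i j)"
    unfolding sum_product sum.cartesian_product fps_sum_nth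
    by (intro sum.cong) (auto simp: power_add mult_ac)
  also have "\<dots> = (\<Sum>(i, j)\<in>{(i, j). i + j \<le> k}. ?g i j)"
    by (rule sum.mono_neutral_right) (use g0 in auto)
  also have "\<dots> = (\<Sum>n\<le>k. \<Sum>i\<le>n. ?g i (n - i))"
    by (rule sum.triangle_reindex_eq)
  also have "\<dots> = fps_nth (fps_subst t (\<lambda>n. \<Sum>i\<le>n. a i * b (n - i))) k"
    by (simp add: fps_subst_def fps_sum_nth sum_distrib_left)
  finally show "fps_nth (fps_subst t a * fps_subst t b) k = \<dots>" .
qed

text \<open>As \<open>t\<close> starts with the variable itself, once the earlier terms vanish the
  coefficient of order \<open>n\<close> is the constant term of \<open>a n\<close>. The last
  hypothesis lets this constant term decide about the whole series \<open>a n\<close>.\<close>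

lemma fps_subst_eq_0:
  assumes "fps_nth t 1 = 1" "fps_subst t a = 0" "\<And>n. fps_nth (a n) 0 = 0 \<Longrightarrow> a n = 0"
  shows "a n = 0"
proof (induction n rule: less_induct)
  case (less n)
  have "fps_nth (t ^ n) n = 1"
    using startsby_zero_power_nth_same[OF t0, of n] assms(1) by simp
  moreover have "fps_nth (t ^ n * a n) n = fps_nth (t ^ n) n * fps_nth (a n) 0"
  proof -
    have "fps_nth (t ^ n * a n) n = (\<Sum>i\<in>{n}. fps_nth (t ^ n) i * fps_nth (a n) (n - i))"
      unfolding fps_mult_nth
      by (rule sum.mono_neutral_right) (use startsby_zero_power_prefix[OF t0, of n] in auto)
    then show ?thesis by simp
  qed
  moreover have "fps_nth (fps_subst t a) n = fps_nth (t ^ n * a n) n"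
    using less by (simp add: fps_subst_def lessThan_Suc_atMost[symmetric])
  ultimately have "fps_nth (a n) 0 = 0" using assms(2) by simp
  then show ?case by (rule assms(3))
qed

end

lemma map_fps_subst:
  assumes "ring_morphism h"
  shows "map_fps h (fps_subst t a) = fps_subst (map_fps h t) (\<lambda>n. map_fps h (a n))"
proof -
  interpret h: ring_morphism h by fact
  interpret H: ring_morphism "map_fps h" by (rule ring_morphism_map_fps) fact
  have "h (fps_nth (\<Sum>n\<le>k. t ^ n * a n) k) = fps_nth (\<Sum>n\<le>k. map_fps h t ^ n * map_fps h (a n)) k" for k
    unfolding map_fps_nth[of h, symmetric] by (simp only: H.hom_sum H.hom_mult H.hom_power)
  then show ?thesis
    by (intro fps_ext) (simp only: fps_subst_def map_fps_nth fps_nth_Abs_fps)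
qed

section \<open>Uniqueness for equations with catalytic variables\<close>

text \<open>Agreement of \<open>A 0\<close> and \<open>B 0\<close> up to some order passes to all
  \<open>A k\<close> and \<open>B k\<close>, because coefficientwise maps respect orders and
  \<open>c\<close> has a nonzero constant term. The factor \<open>t\<close> in the closing equation
  then gains one order.\<close>

lemma catalytic_system_unique:
  fixes A B :: "nat \<Rightarrow> 'a :: idom fps"
  assumes "fps_nth t 0 = 0" "fps_nth c 0 \<noteq> 0"
    and "\<And>k. c * A (Suc k) = (A k - map_fps e (A k)) * map_fps f (A 0)"
    and "A 0 = p + q * t * A m"
    and "\<And>k. c * B (Suc k) = (B k - map_fps e (B k)) * map_fps f (B 0)"
    and "B 0 = p + q * t * B m"
  shows "A k = B k"
proof -
  let ?eq = "\<lambda>n F G. \<forall>i<n. fps_nth F i = fps_nth G i"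
  have step: "?eq n (A (Suc k)) (B (Suc k))" if "?eq n (A k) (B k)" "?eq n (A 0) (B 0)" for n k
  proof (intro allI impI)
    fix i assume "i < n"
    then show "fps_nth (A (Suc k)) i = fps_nth (B (Suc k)) i"
    proof (induction i rule: less_induct)
      case (less i)
      have "fps_nth (c * A (Suc k)) i = fps_nth (c * B (Suc k)) i"
        unfolding assms(3,5) fps_mult_nth using that less.prems by simp
      then have "fps_nth c 0 * fps_nth (A (Suc k)) i + (\<Sum>j=1..i. fps_nth c j * fps_nth (A (Suc k)) (i - j)) =
          fps_nth c 0 * fps_nth (B (Suc k)) i + (\<Sum>j=1..i. fps_nth c j * fps_nth (B (Suc k)) (i - j))"
        by (simp add: fps_mult_nth sum.atLeast_Suc_atMost)
      moreover have "(\<Sum>j=1..i. fps_nth c j * fps_nth (A (Suc k)) (i - j)) =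
          (\<Sum>j=1..i. fps_nth c j * fps_nth (B (Suc k)) (i - j))"
        using less by (intro sum.cong) auto
      ultimately show ?case using assms(2) by simp
    qed
  qed
  have all: "?eq n (A k) (B k)" if "?eq n (A 0) (B 0)" for n k
    using that step by (induction k) blast+
  have "?eq n (A 0) (B 0)" for n
  proof (induction n)
    case (Suc n)
    have *: "fps_nth (t * (q * A m)) i = fps_nth (t * (q * B m)) i" if "i < Suc n" for i
      unfolding fps_mult_nth[of t]
    proof (intro sum.cong refl)
      fix j assume "j \<in> {0..i}"
      show "fps_nth t j * fps_nth (q * A m) (i - j) = fps_nth t j * fps_nth (q * B m) (i - j)"
      proof (cases "j = 0")
        case False
        then have "fps_nth (q * A m) (i - j) = fps_nth (q * B m) (i - j)"
          using all[OF Suc, of m] that \<open>j \<in> {0..i}\<close> unfolding fps_mult_nth by (intro sum.cong) auto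
        then show ?thesis by simp
      qed (simp add: assms(1))
    qed
    have "q * t * A m = t * (q * A m)" "q * t * B m = t * (q * B m)" by (simp_all add: mult_ac)
    with assms(4,6) have AB: "A 0 = p + t * (q * A m)" "B 0 = p + t * (q * B m)" by simp_all
    show ?case
    proof (intro allI impI)
      fix i assume "i < Suc n"
      with * show "fps_nth (A 0) i = fps_nth (B 0) i" by (simp only: AB fps_add_nth)
    qed
  qed simp
  with all have "?eq n (A k) (B k)" for n by blast
  then show ?thesis by (auto intro!: fps_ext)
qed

lemma fps_unit:
  fixes f :: "'a :: comm_ring_1 fps"
  assumes "fps_nth f 0 = 1"
  obtains g where "g * f = 1"
proof
  show "fps_right_inverse f 1 * f = 1"
    using fps_right_inverse[of f 1] assms by (simp add: mult.commute)
qed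

section \<open>The univariate identity\<close>

text \<open>A single variable \<open>w\<close>, which becomes \<open>u\<close> under
  \<open>in_u\<close> and \<open>v\<close> under \<open>in_v\<close>; \<open>fps_X\<close> is the
  \<open>z\<close> of the theorem.\<close>

abbreviation w_ser :: "rat poly fps" where "w_ser \<equiv> fps_const [:0, 1:]"

definition N_ser :: "rat poly fps" where
  "N_ser = (1 + w_ser) * (1 + fps_X * w_ser)"

text \<open>The value at \<open>w = 0\<close> stays in the same ring, so the series free of
  \<open>w\<close> are the fixed points of this map.\<close>

abbreviation at0 :: "rat poly fps \<Rightarrow> rat poly fps" where
  "at0 \<equiv> map_fps (\<lambda>p. [:poly p 0:])"

interpretation at0: ring_morphism at0
  by (intro ring_morphism_map_fps ring_morphism_comp[OF ring_morphism_poly_const] ring_morphism_poly)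

lemma at0_w [simp]: "at0 w_ser = 0"
  by simp

lemma at0_X [simp]: "at0 fps_X = fps_X"
  by (rule map_fps_X) (simp_all add: one_pCons)

lemma at0_at0 [simp]: "at0 (at0 F) = at0 F"
  by (rule fps_ext) simp

lemma w_dvd:
  assumes "at0 F = 0"
  shows "w_ser dvd F"
proof -
  have "\<exists>q. fps_nth F n = [:0, 1:] * q" for n
  proof -
    have "[:poly (fps_nth F n) 0:] = 0" using arg_cong[OF assms, of "\<lambda>G. fps_nth G n"] by simp
    with poly_eq_0_iff_dvd[of "fps_nth F n" 0] have "[:0, 1:] dvd fps_nth F n" by simp
    then show ?thesis by (auto elim: dvdE)
  qed
  then obtain q where "fps_nth F n = [:0, 1:] * q n" for n by metis
  then have "F = w_ser * Abs_fps q" by (intro fps_ext) simp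
  then show ?thesis ..
qed

text \<open>Dividing by \<open>w / N_ser\<close> shifts the coefficients of a series in \<open>w / N_ser\<close>.\<close>

definition shift_by_A :: "rat poly fps \<Rightarrow> rat poly fps" where
  "shift_by_A F = (SOME G. w_ser * G = N_ser * (F - at0 F))"

lemma shift_by_A: "w_ser * shift_by_A F = N_ser * (F - at0 F)"
proof -
  have "at0 (F - at0 F) = 0" by (subst at0.hom_diff) simp
  then obtain G where "F - at0 F = w_ser * G" using w_dvd by blast
  then have "w_ser * (N_ser * G) = N_ser * (F - at0 F)" by (simp add: mult_ac)
  then show ?thesis unfolding shift_by_A_def by (rule someI)
qed

text \<open>These are \<open>w ^ (m + 1)\<close> times polynomials in \<open>N / w\<close> of degree
  at most \<open>m + 1\<close> without constant term, with coefficients in \<open>S\<close>, written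
  homogeneously to avoid dividing by \<open>w\<close>.\<close>

definition N_combinations :: "'a set \<Rightarrow> 'a :: comm_ring_1 \<Rightarrow> 'a \<Rightarrow> nat \<Rightarrow> 'a set" where
  "N_combinations S w N m = {\<Sum>k\<le>m. d k * w ^ k * N ^ (m + 1 - k) | d. \<forall>k. d k \<in> S}"

context
  fixes S :: "'a :: comm_ring_1 set"
  assumes S: "1 \<in> S" "\<And>a b. a \<in> S \<Longrightarrow> b \<in> S \<Longrightarrow> a - b \<in> S" "\<And>a b. a \<in> S \<Longrightarrow> b \<in> S \<Longrightarrow> a * b \<in> S"
begin

lemma zero_in: "0 \<in> S"
  using S(1) S(2)[of 1 1] by simp

lemma add_in: "a \<in> S \<Longrightarrow> b \<in> S \<Longrightarrow> a + b \<in> S"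
  using S(2)[of a "0 - b"] S(2)[of 0 b] zero_in by simp

lemma power_in: "a \<in> S \<Longrightarrow> a ^ n \<in> S"
  by (induction n) (simp_all add: S)

lemma N_combinationsI: "\<forall>k. d k \<in> S \<Longrightarrow> p = (\<Sum>k\<le>m. d k * w ^ k * N ^ (m + 1 - k)) \<Longrightarrow> p \<in> N_combinations S w N m"
  unfolding N_combinations_def by blast

lemma N_combinations_diff:
  assumes "p \<in> N_combinations S w N m" "q \<in> N_combinations S w N m"
  shows "p - q \<in> N_combinations S w N m"
proof -
  from assms obtain d e where "\<forall>k. d k \<in> S" "\<forall>k. e k \<in> S"
    "p = (\<Sum>k\<le>m. d k * w ^ k * N ^ (m + 1 - k))" "q = (\<Sum>k\<le>m. e k * w ^ k * N ^ (m + 1 - k))"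
    by (auto simp: N_combinations_def)
  then show ?thesis
    by (intro N_combinationsI[of "\<lambda>k. d k - e k"]) (simp_all add: S left_diff_distrib sum_subtractf)
qed

lemma N_combinations_scale:
  assumes "p \<in> N_combinations S w N m" "c \<in> S"
  shows "c * p \<in> N_combinations S w N m"
proof -
  from assms obtain d where "\<forall>k. d k \<in> S" "p = (\<Sum>k\<le>m. d k * w ^ k * N ^ (m + 1 - k))"
    by (auto simp: N_combinations_def)
  with assms(2) show ?thesis
    by (intro N_combinationsI[of "\<lambda>k. c * d k"]) (simp_all add: S sum_distrib_left mult.assoc)
qed

lemma N_combinations_add:
  assumes "p \<in> N_combinations S w N m" "q \<in> N_combinations S w N m"
  shows "p + q \<in> N_combinations S w N m"
  using N_combinations_diff[OF assms(1) N_combinations_scale[OF assms(2), of "0 - 1"]] S(1)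
    S(2)[of 0 1] zero_in by simp

lemma N_combinations_top: "w ^ m * N \<in> N_combinations S w N m"
proof (rule N_combinationsI[of "\<lambda>k. if k = m then 1 else 0"])
  have "(\<Sum>k\<le>m. (if k = m then 1 else 0) * w ^ k * N ^ (m + 1 - k)) =
      (\<Sum>k\<le>m. if k = m then w ^ k * N ^ (m + 1 - k) else 0)"
    by (intro sum.cong) auto
  then show "w ^ m * N = (\<Sum>k\<le>m. (if k = m then 1 else 0) * w ^ k * N ^ (m + 1 - k))"
    by simp
qed (simp add: S zero_in)

lemma N_combinations_times_N:
  assumes "p \<in> N_combinations S w N m"
  shows "N * p \<in> N_combinations S w N (Suc m)"
proof -
  from assms obtain d where d: "\<forall>k. d k \<in> S" "p = (\<Sum>k\<le>m. d k * w ^ k * N ^ (m + 1 - k))"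
    by (auto simp: N_combinations_def)
  show ?thesis
  proof (rule N_combinationsI[of "\<lambda>k. if k \<le> m then d k else 0"])
    have "N * (d k * w ^ k * N ^ (m + 1 - k)) = d k * w ^ k * N ^ (Suc m + 1 - k)" if "k \<le> m" for k
      using that by (simp add: Suc_diff_le mult_ac)
    then show "N * p = (\<Sum>k\<le>Suc m. (if k \<le> m then d k else 0) * w ^ k * N ^ (Suc m + 1 - k))"
      unfolding d(2) sum_distrib_left by (simp del: power_Suc)
  qed (simp add: d zero_in)
qed

lemma N_combinations_times_w:
  assumes "p \<in> N_combinations S w N m"
  shows "w * p \<in> N_combinations S w N (Suc m)"
proof -
  from assms obtain d where d: "\<forall>k. d k \<in> S" "p = (\<Sum>k\<le>m. d k * w ^ k * N ^ (m + 1 - k))"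
    by (auto simp: N_combinations_def)
  show ?thesis
  proof (rule N_combinationsI[of "\<lambda>k. if k = 0 then 0 else d (k - 1)"])
    show "w * p = (\<Sum>k\<le>Suc m. (if k = 0 then 0 else d (k - 1)) * w ^ k * N ^ (Suc m + 1 - k))"
      unfolding d(2) sum_distrib_left by (subst sum.atMost_Suc_shift) (simp add: mult_ac)
  qed (simp add: d zero_in)
qed

text \<open>Divided by \<open>w ^ (m + 1)\<close>, the left-hand side is invariant under \<open>w \<mapsto> 1 / (z w)\<close>,
  hence it is a combination of powers of \<open>N / w = 1 / w + 1 + z + z w\<close>. With \<open>\<alpha> = 1 + w\<close>,
  \<open>\<beta> = w (1 + z w)\<close> and \<open>\<gamma> = w (1 - z)\<close>, the recurrence used in the induction follows from
  \<open>\<alpha> \<beta> = w N\<close> and \<open>\<alpha> + \<beta> = N + \<gamma>\<close>.\<close>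

lemma palindromic_in_N_combinations:
  fixes z w :: 'a
  assumes "z \<in> S"
  defines "N \<equiv> (1 + w) * (1 + z * w)"
  shows "z * (1 + w) ^ (m + 2) + w ^ m * (1 + z * w) ^ (m + 2) + w ^ (m + 1) * (1 - z) ^ (m + 2)
    \<in> N_combinations S w N m" (is "?p m \<in> _")
proof (induction m rule: induct_nat_012)
  case 0
  have "?p 0 = (1 + z) * (w ^ 0 * N)" by (simp add: N_def algebra_simps power2_eq_square)
  then show ?case using N_combinations_scale[OF N_combinations_top, of "1 + z" w 0 N] S assms add_in by simp
next
  case 1
  have "?p 1 = z * (N * (w ^ 0 * N)) + (1 + z - (1 + 1) * z * z) * (w ^ 1 * N)"
    by (simp add: N_def algebra_simps eval_nat_numeral)
  moreover have "z * (N * (w ^ 0 * N)) \<in> N_combinations S w N (Suc 0)"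
    by (intro N_combinations_scale N_combinations_times_N N_combinations_top assms)
  moreover have "(1 + z - (1 + 1) * z * z) * (w ^ 1 * N) \<in> N_combinations S w N 1"
    by (intro N_combinations_scale N_combinations_top S add_in assms)
  ultimately show ?case using N_combinations_add by simp
next
  case (ge2 m)
  have *: "?p (Suc (Suc m)) = N * ?p (Suc m) + (1 - z) * (w * ?p (Suc m)) - w * (N * ?p m)
      + (z * (1 - z) ^ (m + 2)) * (w ^ Suc (Suc m) * N)"
  proof -
    \<comment> \<open>The letters stand for the \<open>m\<close>-th powers of \<open>1 + w\<close>,
      \<open>1 + z * w\<close>, \<open>w\<close> and \<open>1 - z\<close>, which leaves an identity
      of fixed degree that expansion can check.\<close>
    have "z * (a * (1 + w) ^ 4) + c * w ^ 2 * (b * (1 + z * w) ^ 4) + c * w ^ 3 * (r * (1 - z) ^ 4) =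
      N * (z * (a * (1 + w) ^ 3) + c * w * (b * (1 + z * w) ^ 3) + c * w ^ 2 * (r * (1 - z) ^ 3)) +
      (1 - z) * (w * (z * (a * (1 + w) ^ 3) + c * w * (b * (1 + z * w) ^ 3) + c * w ^ 2 * (r * (1 - z) ^ 3))) -
      w * (N * (z * (a * (1 + w) ^ 2) + c * (b * (1 + z * w) ^ 2) + c * w * (r * (1 - z) ^ 2))) +
      z * (r * (1 - z) ^ 2) * (c * w ^ 2 * N)" for a b c r
      unfolding N_def by (simp add: algebra_simps eval_nat_numeral)
    from this[of "(1 + w) ^ m" "w ^ m" "(1 + z * w) ^ m" "(1 - z) ^ m"] show ?thesis
      by (simp only: power_add[symmetric] power_Suc2[symmetric] add_Suc add_Suc_right add_2_eq_Suc')
        (simp add: eval_nat_numeral mult_ac)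
  qed
  show ?case unfolding *
    by (intro N_combinations_add N_combinations_diff N_combinations_times_N N_combinations_times_w
        N_combinations_scale N_combinations_top ge2 S add_in power_in assms)
qed

end

lemma at0_N [simp]: "at0 N_ser = 1"
  unfolding N_ser_def by (simp only: at0.hom_mult at0.hom_add at0.hom_one at0_w at0_X) simp

lemma at0_in_closed:
  "1 \<in> {F. at0 F = F}"
  "F \<in> {F. at0 F = F} \<Longrightarrow> G \<in> {F. at0 F = F} \<Longrightarrow> F - G \<in> {F. at0 F = F}"
  "F \<in> {F. at0 F = F} \<Longrightarrow> G \<in> {F. at0 F = F} \<Longrightarrow> F * G \<in> {F. at0 F = F}"
  by (simp_all only: mem_Collect_eq at0.hom_one at0.hom_diff at0.hom_mult)

section \<open>Iterated shifts of x\<close>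

definition J_ser :: "rat poly fps" where
  "J_ser = (SOME G. G * (1 + fps_X * w_ser) = 1)"

lemma J_ser: "J_ser * (1 + fps_X * w_ser) = 1"
  unfolding J_ser_def by (rule someI_ex, rule fps_unit[of "1 + fps_X * w_ser"]) auto

definition X_ser :: "nat \<Rightarrow> nat \<Rightarrow> rat poly fps" where
  "X_ser m k = (shift_by_A ^^ k) ((1 + w_ser) * J_ser ^ (m + 1))"

lemma X_ser_Suc: "w_ser * X_ser m (Suc k) = N_ser * (X_ser m k - at0 (X_ser m k))"
  by (simp add: X_ser_def shift_by_A)

lemma X_ser_0: "X_ser m 0 * (1 + fps_X * w_ser) ^ (m + 1) = 1 + w_ser"
proof -
  have "X_ser m 0 * (1 + fps_X * w_ser) ^ (m + 1) = (1 + w_ser) * (J_ser * (1 + fps_X * w_ser)) ^ (m + 1)"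
    unfolding X_ser_def power_mult_distrib by (simp add: mult_ac)
  then show ?thesis by (simp only: J_ser) simp
qed

lemma at0_X_ser_0: "at0 (X_ser m 0) = 1"
  using arg_cong[OF X_ser_0[of m], of at0]
  by (simp only: at0.hom_mult at0.hom_add at0.hom_one at0.hom_power at0_w at0_X) simp

lemma w_ser_nonzero: "w_ser \<noteq> 0"
  by (simp add: fps_eq_iff)

text \<open>Divided by \<open>N_ser\<close>, this is the independence of \<open>w\<close> announced
  for \<open>z X + 1 / x + (1 - z)^(m + 2) A\<close>. The expansion from
  \<open>palindromic_in_N_combinations\<close> has coefficients free of \<open>w\<close>; each shift
  deletes the leading one, and after \<open>m\<close> shifts only one is left.\<close>

lemma X_ser_last:
  "\<exists>C. at0 C = C \<and> fps_X * N_ser * X_ser m m + (1 + fps_X * w_ser) ^ (m + 2) + (1 - fps_X) ^ (m + 2) * w_ser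
     = C * N_ser"
proof -
  define E where "E = (1 + fps_X * w_ser) ^ (m + 2) + (1 - fps_X) ^ (m + 2) * w_ser"
  have "fps_X \<in> {F. at0 F = F}" by simp
  from palindromic_in_N_combinations[OF at0_in_closed this, of w_ser m]
  obtain d where d: "\<And>k. at0 (d k) = d k"
    "fps_X * (1 + w_ser) ^ (m + 2) + w_ser ^ m * (1 + fps_X * w_ser) ^ (m + 2)
      + w_ser ^ (m + 1) * (1 - fps_X) ^ (m + 2) = (\<Sum>k\<le>m. d k * w_ser ^ k * N_ser ^ (m + 1 - k))"
    unfolding N_combinations_def N_ser_def by blast
  \<comment> \<open>\<open>n\<close> is the number of shifts still to come: \<open>k\<close>
    coefficients are gone, and dividing \<open>w ^ m * E\<close> by \<open>w\<close> at each shift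
    has left \<open>w ^ n * E\<close>.\<close>
  have "fps_X * N_ser ^ (n + 1) * X_ser m k =
      (\<Sum>i\<le>n. d (k + i) * w_ser ^ i * N_ser ^ (n + 1 - i)) - w_ser ^ n * E" if "k + n = m" for k n
    using that
  proof (induction k arbitrary: n)
    case 0
    then have "fps_X * N_ser ^ (n + 1) * X_ser m 0 =
        fps_X * (1 + w_ser) ^ (m + 1) * (X_ser m 0 * (1 + fps_X * w_ser) ^ (m + 1))"
      by (simp add: N_ser_def power_mult_distrib mult_ac)
    also have "\<dots> = fps_X * (1 + w_ser) ^ (m + 2)"
      by (simp only: X_ser_0) (simp add: mult_ac)
    also have "\<dots> = (\<Sum>k\<le>m. d k * w_ser ^ k * N_ser ^ (m + 1 - k)) - w_ser ^ m * E"
      unfolding d(2)[symmetric] E_def by (simp add: algebra_simps)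
    finally show ?case using 0 by simp
  next
    case (Suc k)
    let ?V = "\<Sum>i\<le>n. d (Suc k + i) * w_ser ^ i * N_ser ^ (n + 1 - i)"
    have IH: "fps_X * N_ser ^ (n + 2) * X_ser m k = d k * N_ser ^ (n + 2) + w_ser * (?V - w_ser ^ n * E)"
    proof -
      have "fps_X * N_ser ^ (n + 2) * X_ser m k =
          (\<Sum>i\<le>Suc n. d (k + i) * w_ser ^ i * N_ser ^ (Suc n + 1 - i)) - w_ser ^ Suc n * E"
        using Suc.IH[of "Suc n"] Suc.prems by simp
      also have "(\<Sum>i\<le>Suc n. d (k + i) * w_ser ^ i * N_ser ^ (Suc n + 1 - i)) =
          d k * N_ser ^ (n + 2) + w_ser * ?V"
        by (subst sum.atMost_Suc_shift) (simp add: sum_distrib_left mult_ac del: fps_const_power fps_const_mult)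
      finally show ?thesis by (simp add: algebra_simps)
    qed
    \<comment> \<open>At \<open>w = 0\<close> only the leading term survives, so \<open>d k\<close>
      is \<open>z\<close> times the constant that the shift subtracts.\<close>
    from arg_cong[OF this, of at0] have c: "fps_X * at0 (X_ser m k) = d k"
      by (simp only: at0.hom_mult at0.hom_add at0.hom_power at0_N at0_w at0_X d(1)) simp
    have "w_ser * (fps_X * N_ser ^ (n + 1) * X_ser m (Suc k)) =
        fps_X * N_ser ^ (n + 1) * (w_ser * X_ser m (Suc k))" by (simp only: mult_ac)
    also have "\<dots> = fps_X * N_ser ^ (n + 2) * X_ser m k - (fps_X * at0 (X_ser m k)) * N_ser ^ (n + 2)"
      unfolding X_ser_Suc by (simp add: algebra_simps)
    also have "\<dots> = w_ser * (?V - w_ser ^ n * E)" unfolding IH c by simp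
    finally show ?case using mult_left_cancel[OF w_ser_nonzero] by blast
  qed
  from this[of m 0] have "fps_X * N_ser * X_ser m m = d m * N_ser - E" by simp
  with d(1) show ?thesis by (intro exI[of _ "d m"]) (simp add: E_def algebra_simps)
qed

section \<open>The candidate solution\<close>

type_synonym poly_series = "rat poly poly fps"

abbreviation const2 :: "rat \<Rightarrow> rat poly poly" where "const2 c \<equiv> [:[:c:]:]"

lemma ring_morphism_const2: "ring_morphism const2"
  by (intro ring_morphism_comp[OF ring_morphism_poly_const] ring_morphism_poly_const)

abbreviation u_ser :: poly_series where "u_ser \<equiv> fps_const var1"
abbreviation v_ser :: poly_series where "v_ser \<equiv> fps_const var2"

text \<open>Because \<open>x_ser\<close> is 1 at \<open>u = 0\<close> and \<open>y_ser\<close> is 1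
  at \<open>v = 0\<close>, these maps realise \<open>x = 1\<close> and \<open>y = 1\<close>; the
  exchange of \<open>u\<close> and \<open>v\<close> exchanges \<open>x\<close> and
  \<open>y\<close>.\<close>

abbreviation set_u0 :: "poly_series \<Rightarrow> poly_series" where "set_u0 \<equiv> map_fps (eval2 const2 0 var2)"
abbreviation set_v0 :: "poly_series \<Rightarrow> poly_series" where "set_v0 \<equiv> map_fps (eval2 const2 var1 0)"
abbreviation swap_uv :: "poly_series \<Rightarrow> poly_series" where "swap_uv \<equiv> map_fps (eval2 const2 var2 var1)"

abbreviation in_u :: "rat poly fps \<Rightarrow> poly_series" where "in_u \<equiv> map_fps (\<lambda>p. [:p:])"
abbreviation in_v :: "rat poly fps \<Rightarrow> poly_series" where "in_v F \<equiv> swap_uv (in_u F)"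

lemmas ring_morphism_eval2_const2 = ring_morphism_eval2[OF ring_morphism_const2]
lemmas eval2_const2_simps [simp] = eval2_simps[OF ring_morphism_const2]

interpretation set_u0: ring_morphism set_u0
  by (intro ring_morphism_map_fps ring_morphism_eval2_const2)
interpretation set_v0: ring_morphism set_v0
  by (intro ring_morphism_map_fps ring_morphism_eval2_const2)
interpretation swap_uv: ring_morphism swap_uv
  by (intro ring_morphism_map_fps ring_morphism_eval2_const2)
interpretation in_u: ring_morphism in_u
  by (intro ring_morphism_map_fps ring_morphism_poly_const)

lemma eval2_const2_0_1 [simp]: "eval2 const2 a b 0 = 0" "eval2 const2 a b 1 = 1"
  using ring_morphism.hom_zero[OF ring_morphism_eval2_const2]
    ring_morphism.hom_one[OF ring_morphism_eval2_const2] by blast+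

lemma eval2_in_u:
  "eval2 const2 a b [:p:] = poly (map_poly const2 p) a"
  by (simp add: eval2_def map_poly_pCons)

lemma poly_map_poly_const2:
  "poly (map_poly const2 p) var1 = [:p:]" "poly (map_poly const2 p) 0 = const2 (poly p 0)"
proof -
  have 1: "ring_morphism (\<lambda>p. poly (map_poly const2 p) a)" for a
    by (intro ring_morphism_comp[OF ring_morphism_poly] ring_morphism_map_poly ring_morphism_const2)
  show "poly (map_poly const2 p) var1 = [:p:]"
    by (rule ring_morphism_poly_eqI[OF 1 ring_morphism_poly_const]) (simp_all add: map_poly_pCons)
  show "poly (map_poly const2 p) 0 = const2 (poly p 0)"
    by (rule ring_morphism_poly_eqI[OF 1
          ring_morphism_comp[OF ring_morphism_const2 ring_morphism_poly]]) (simp_all add: map_poly_pCons)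
qed

lemma eval2_swap: "eval2 const2 a b (eval2 const2 var2 var1 p) = eval2 const2 b a p"
  by (rule ring_morphism_poly_poly_eqI[OF ring_morphism_comp[OF
        ring_morphism_eval2_const2 ring_morphism_eval2_const2] ring_morphism_eval2_const2])
     simp_all

lemma series_morphisms [simp]:
  "set_u0 fps_X = fps_X" "set_v0 fps_X = fps_X" "swap_uv fps_X = fps_X"
  "set_u0 u_ser = 0" "set_u0 v_ser = v_ser" "set_v0 u_ser = u_ser" "set_v0 v_ser = 0"
  "swap_uv u_ser = v_ser" "swap_uv v_ser = u_ser" "in_u w_ser = u_ser"
  by simp_all

lemma in_u_X [simp]: "in_u fps_X = fps_X"
  by (simp add: one_pCons)

lemma in_u_in_v_simps [simp]:
  "set_v0 (in_u F) = in_u F" "set_u0 (in_u F) = in_u (at0 F)"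
  "set_u0 (in_v F) = in_v F" "set_v0 (in_v F) = in_u (at0 F)"
  "in_v (at0 F) = in_u (at0 F)" "swap_uv (in_v F) = in_u F"
  by (auto intro!: fps_ext simp: eval2_swap) (simp_all add: eval2_in_u poly_map_poly_const2)

text \<open>For a polynomial \<open>c + w p(w)\<close> the difference is
  \<open>u (p(u) - p(v)) + (u - v) p(v)\<close>, which drives an induction; series follow
  coefficientwise.\<close>

lemma diff_dvd_in_u_in_v: "(u_ser - v_ser) dvd in_u F - in_v F"
proof -
  have "(var1 - var2) dvd [:p:] - eval2 const2 var2 var1 [:p:]" for p
  proof (induction p)
    case (pCons c p)
    interpret ring_morphism "eval2 const2 var2 var1" by (rule ring_morphism_eval2_const2)
    have p: "[:pCons c p:] = const2 c + var1 * [:p:]" by simp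
    have "[:pCons c p:] - eval2 const2 var2 var1 [:pCons c p:] =
        var1 * ([:p:] - eval2 const2 var2 var1 [:p:]) + (var1 - var2) * eval2 const2 var2 var1 [:p:]"
      unfolding p hom_add hom_mult eval2_const2_simps by (simp only: algebra_simps)
    with pCons show ?case by (simp only: dvd_add dvd_mult dvd_mult2 dvd_refl dvd_triv_left)
  qed (simp add: eval2_in_u)
  then obtain q where "[:p:] - eval2 const2 var2 var1 [:p:] = (var1 - var2) * q p" for p
    unfolding dvd_def by metis
  then have "in_u F - in_v F = (u_ser - v_ser) * map_fps q F"
    unfolding fps_const_sub
    by (intro fps_ext) (simp only: fps_sub_nth map_fps_nth fps_mult_left_const_nth)
  then show ?thesis ..
qed

definition T_ser :: "nat \<Rightarrow> nat \<Rightarrow> poly_series" where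
  "T_ser m k = (SOME T. (u_ser - v_ser) * T = in_u (X_ser m k) - in_v (X_ser m k))"

lemma T_ser: "(u_ser - v_ser) * T_ser m k = in_u (X_ser m k) - in_v (X_ser m k)"
  unfolding T_ser_def by (rule someI_ex) (metis diff_dvd_in_u_in_v dvdE)

definition x_ser :: "nat \<Rightarrow> poly_series" where "x_ser m = in_u (X_ser m 0)"
definition y_ser :: "nat \<Rightarrow> poly_series" where "y_ser m = in_v (X_ser m 0)"

lemma in_u_N: "in_u N_ser = (1 + u_ser) * (1 + fps_X * u_ser)"
  unfolding N_ser_def by (simp only: in_u.hom_mult in_u.hom_add in_u.hom_one in_u_X series_morphisms)

lemma in_v_N: "in_v N_ser = (1 + v_ser) * (1 + fps_X * v_ser)"
  unfolding in_u_N by (simp only: swap_uv.hom_mult swap_uv.hom_add swap_uv.hom_one series_morphisms)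

lemma x_ser: "x_ser m * (1 + fps_X * u_ser) ^ (m + 1) = 1 + u_ser"
  using arg_cong[OF X_ser_0[of m], of in_u] unfolding x_ser_def
  by (simp only: in_u.hom_mult in_u.hom_add in_u.hom_one in_u.hom_power in_u_X series_morphisms)

lemma swap_x_ser [simp]: "swap_uv (x_ser m) = y_ser m" "swap_uv (y_ser m) = x_ser m"
  by (simp_all add: x_ser_def y_ser_def)

lemma y_ser: "y_ser m * (1 + fps_X * v_ser) ^ (m + 1) = 1 + v_ser"
  using arg_cong[OF x_ser[of m], of swap_uv]
  by (simp only: swap_uv.hom_mult swap_uv.hom_add swap_uv.hom_one swap_uv.hom_power series_morphisms
      swap_x_ser)

lemma set_x_ser [simp]:
  "set_u0 (x_ser m) = 1" "set_v0 (x_ser m) = x_ser m"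
  "set_u0 (y_ser m) = y_ser m" "set_v0 (y_ser m) = 1"
  by (simp_all add: x_ser_def y_ser_def at0_X_ser_0)

lemma nonzero_series:
  "u_ser \<noteq> 0" "v_ser \<noteq> 0" "u_ser - v_ser \<noteq> 0" "1 - fps_X * u_ser * v_ser \<noteq> 0"
  "(1 - fps_X :: poly_series) \<noteq> 0" "in_v N_ser \<noteq> 0"
proof -
  have nz: "F \<noteq> 0" if "fps_nth F 0 \<noteq> 0" for F :: poly_series
    using that by auto
  show "u_ser \<noteq> 0" "v_ser \<noteq> 0" "u_ser - v_ser \<noteq> 0" "1 - fps_X * u_ser * v_ser \<noteq> 0"
    "(1 - fps_X :: poly_series) \<noteq> 0"
    by (rule nz, simp add: one_pCons)+
  show "in_v N_ser \<noteq> 0"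
    unfolding in_v_N by (rule nz) (simp add: one_pCons)
qed

definition gf_factor :: "nat \<Rightarrow> nat \<Rightarrow> poly_series" where
  "gf_factor m k = (SOME G. G * ((1 - fps_X * u_ser * v_ser) * (1 - fps_X) ^ ((m + 2) * (k + 1))) = 1)"

lemma gf_factor:
  "gf_factor m k * ((1 - fps_X * u_ser * v_ser) * (1 - fps_X) ^ ((m + 2) * (k + 1))) = 1"
  unfolding gf_factor_def
  by (rule someI_ex, rule fps_unit[of "(1 - fps_X * u_ser * v_ser) * (1 - fps_X) ^ ((m + 2) * (k + 1))"])
     (auto simp: fps_nth_power_0)

text \<open>The candidate for the series of \<open>weight m k\<close>. As
  \<open>1 / y = (1 + z v)^(m + 2) / N(v)\<close>, it is
  \<open>(X(u) - X(v)) / (A(u) - A(v))\<close> divided by \<open>y\<close> and by a power of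
  \<open>1 - z\<close>, where \<open>X\<close> is the \<open>k\<close>-fold shift of
  \<open>x\<close>.\<close>

definition H_ser :: "nat \<Rightarrow> nat \<Rightarrow> poly_series" where
  "H_ser m k = T_ser m k * in_u N_ser * (1 + fps_X * v_ser) ^ (m + 2) * gf_factor m k"

lemma H_ser:
  "(u_ser - v_ser) * (1 - fps_X * u_ser * v_ser) * (1 - fps_X) ^ ((m + 2) * (k + 1)) * H_ser m k =
   in_u N_ser * (1 + fps_X * v_ser) ^ (m + 2) * (in_u (X_ser m k) - in_v (X_ser m k))"
proof -
  have "d * e * H_ser m k = in_u N_ser * (1 + fps_X * v_ser) ^ (m + 2) * (d * T_ser m k) * (gf_factor m k * e)"
    for d e unfolding H_ser_def by (simp only: mult_ac)
  from this[of "u_ser - v_ser" "(1 - fps_X * u_ser * v_ser) * (1 - fps_X) ^ ((m + 2) * (k + 1))"]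
  show ?thesis unfolding T_ser gf_factor by (simp only: mult.assoc mult_1_right)
qed

text \<open>Since \<open>A(0) = 0\<close>, the divided difference at \<open>u = 0\<close> is
  \<open>(X(v) - X(0)) / A(v)\<close>, the next shift of \<open>X\<close>.\<close>

lemma H_ser_set_u0:
  "in_v N_ser * (1 - fps_X) ^ ((m + 2) * (k + 1)) * set_u0 (H_ser m k) =
   (1 + fps_X * v_ser) ^ (m + 2) * in_v (X_ser m (Suc k))"
proof -
  have "in_u (at0 N_ser) = 1" by (simp only: at0_N in_u.hom_one)
  with arg_cong[OF H_ser[of m k], of set_u0]
  have 1: "- v_ser * (1 - fps_X) ^ ((m + 2) * (k + 1)) * set_u0 (H_ser m k) =
      (1 + fps_X * v_ser) ^ (m + 2) * (in_u (at0 (X_ser m k)) - in_v (X_ser m k))"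
    by (simp only: set_u0.hom_mult set_u0.hom_diff set_u0.hom_add set_u0.hom_one set_u0.hom_power
        series_morphisms in_u_in_v_simps) simp
  have 2: "v_ser * in_v (X_ser m (Suc k)) = in_v N_ser * (in_v (X_ser m k) - in_u (at0 (X_ser m k)))"
    using arg_cong[OF X_ser_Suc[of m k], of in_v]
    by (simp only: swap_uv.hom_mult swap_uv.hom_diff in_u.hom_mult in_u.hom_diff series_morphisms in_u_in_v_simps)
  have "v_ser * (in_v N_ser * (1 - fps_X) ^ ((m + 2) * (k + 1)) * set_u0 (H_ser m k)) =
      - in_v N_ser * (- v_ser * (1 - fps_X) ^ ((m + 2) * (k + 1)) * set_u0 (H_ser m k))"
    by (simp only: mult_ac mult_minus_left mult_minus_right minus_minus)
  also have "\<dots> = (1 + fps_X * v_ser) ^ (m + 2) * (v_ser * in_v (X_ser m (Suc k)))"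
    unfolding 1 2 by (simp add: algebra_simps)
  also have "\<dots> = v_ser * ((1 + fps_X * v_ser) ^ (m + 2) * in_v (X_ser m (Suc k)))"
    by (simp only: mult_ac)
  finally show ?thesis using mult_left_cancel[OF nonzero_series(2)] by blast
qed

text \<open>The candidate for \<open>F(x,1)\<close> is
  \<open>(x - 1) / ((1 - z)^(m + 2) A(u))\<close>; this makes \<open>F(x,1) \<Delta>\<close> a shift
  up to a power of \<open>1 - z\<close>.\<close>

lemma H_ser_0_set_v0:
  "u_ser * (1 - fps_X) ^ (m + 2) * set_v0 (H_ser m 0) = in_u N_ser * (x_ser m - 1)"
proof -
  have "in_u (at0 (X_ser m 0)) = 1" by (simp only: at0_X_ser_0 in_u.hom_one)
  with arg_cong[OF H_ser[of m 0], of set_v0] show ?thesis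
    by (simp only: set_v0.hom_mult set_v0.hom_diff set_v0.hom_add set_v0.hom_one set_v0.hom_power
        series_morphisms in_u_in_v_simps flip: x_ser_def) simp
qed

section \<open>Verification of the functional equation for the candidate\<close>

lemma kernel_factorization:
  fixes u v z :: "'a :: comm_ring_1"
  shows "(1 + u) * (1 + z * u) * v - (1 + v) * (1 + z * v) * u = - ((u - v) * (1 - z * u * v))"
  by (simp add: algebra_simps)

lemma N_diff:
  "in_u N_ser * v_ser - in_v N_ser * u_ser = - ((u_ser - v_ser) * (1 - fps_X * u_ser * v_ser))"
  unfolding in_v_N unfolding in_u_N by (rule kernel_factorization)

text \<open>The shift commutes with the divided difference, stated in abstract letters to become a
  question of ideal membership. \<open>N\<close> and \<open>M\<close> are \<open>N(u)\<close> and
  \<open>N(v)\<close>, \<open>e\<close> is \<open>1 - z u v\<close>, primes mark the next shift, and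
  the subtracted constant \<open>c\<close> is common to \<open>u\<close> and
  \<open>v\<close>.\<close>

lemma step_algebra:
  fixes N :: "'a :: idom"
  assumes h: "(u - v) * e * W * H = N * Y * (X - V)"
    and h': "(u - v) * e * (Z * W) * H' = N * Y * (X' - V')"
    and h0: "M * W * H0 = Y * V'"
    and x': "u * X' = N * (X - c)" and v': "v * V' = M * (V - c)"
    and nd: "N * v - M * u = - ((u - v) * e)"
    and nz: "M * (u - v) * e * W \<noteq> 0"
  shows "u * Z * H' = N * (H - H0)"
proof -
  have "M * (u - v) * e * W * (u * Z * H' - N * (H - H0)) = 0"
    using h h' h0 x' v' nd by algebra
  then show ?thesis using nz by simp
qed

text \<open>Eliminating the common \<open>C\<close> gives
  \<open>z (X - V) = 1 / y - 1 / x - Z (A(u) - A(v))\<close>, which turns the divided difference of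
  \<open>X\<close> into that of \<open>x\<close>.\<close>

lemma closing_algebra:
  fixes N :: "'a :: idom"
  assumes h: "(u - v) * e * Z * H = N * Y * (x - y)"
    and h': "(u - v) * e * (Z * T) * H' = N * Y * (X - V)"
    and xL: "x * L = N" and yY: "y * Y = M"
    and c: "z * N * X + L + Z * u = C * N" and c': "z * M * V + Y + Z * v = C * M"
    and nd: "N * v - M * u = - ((u - v) * e)"
    and nz: "(u - v) * e * Z \<noteq> 0"
  shows "H = x + (x * y) * (z * T) * H'"
proof -
  have "(u - v) * e * Z * H = (u - v) * e * Z * (x + (x * y) * (z * T) * H')"
    using h h' xL yY c c' nd by algebra
  then show ?thesis using mult_left_cancel[OF nz] by blast
qed

lemma H_ser_step:
  "(x_ser m - 1) * H_ser m (Suc k) = (H_ser m k - set_u0 (H_ser m k)) * set_v0 (H_ser m 0)"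
proof -
  define N where "N = in_u N_ser"
  define M where "M = in_v N_ser"
  define u where "u = u_ser"
  define v where "v = v_ser"
  define e where "e = 1 - fps_X * u * v"
  define Z where "Z = (1 - fps_X :: poly_series) ^ (m + 2)"
  define W where "W = (1 - fps_X :: poly_series) ^ ((m + 2) * (k + 1))"
  define Y where "Y = (1 + fps_X * v) ^ (m + 2)"
  define X where "X = in_u (X_ser m k)"
  define V where "V = in_v (X_ser m k)"
  define X' where "X' = in_u (X_ser m (Suc k))"
  define V' where "V' = in_v (X_ser m (Suc k))"
  define c where "c = in_u (at0 (X_ser m k))"
  define H where "H = H_ser m k"
  define H' where "H' = H_ser m (Suc k)"
  define H0 where "H0 = set_u0 H"
  have W': "(1 - fps_X :: poly_series) ^ ((m + 2) * (Suc k + 1)) = Z * W"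
  proof -
    have "(m + 2) * (Suc k + 1) = (m + 2) + (m + 2) * (k + 1)" by simp
    then show ?thesis unfolding Z_def W_def by (simp only: power_add)
  qed
  have h: "(u - v) * e * W * H = N * Y * (X - V)"
    using H_ser[of m k] by (simp only: N_def u_def v_def e_def W_def Y_def X_def V_def H_def)
  have h': "(u - v) * e * (Z * W) * H' = N * Y * (X' - V')"
    using H_ser[of m "Suc k"]
    by (simp only: W') (simp only: N_def u_def v_def e_def Y_def X'_def V'_def H'_def)
  have h0: "M * W * H0 = Y * V'"
    using H_ser_set_u0[of m k] by (simp only: M_def W_def H_def H0_def Y_def v_def V'_def)
  have x': "u * X' = N * (X - c)"
    using arg_cong[OF X_ser_Suc[of m k], of in_u]
    by (simp only: in_u.hom_mult in_u.hom_diff series_morphisms in_u_in_v_simps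
        u_def X'_def N_def X_def c_def)
  have v': "v * V' = M * (V - c)"
    using arg_cong[OF X_ser_Suc[of m k], of in_v]
    by (simp only: swap_uv.hom_mult swap_uv.hom_diff in_u.hom_mult in_u.hom_diff series_morphisms
        in_u_in_v_simps v_def V'_def M_def V_def c_def)
  have nd: "N * v - M * u = - ((u - v) * e)"
    using N_diff by (simp only: N_def M_def u_def v_def e_def)
  have nz: "M * (u - v) * e * W \<noteq> 0"
    using nonzero_series by (simp add: M_def u_def v_def e_def W_def)
  have key: "u * Z * H' = N * (H - H0)"
    by (rule step_algebra[OF h h' h0 x' v' nd nz])
  have ev: "u * Z * set_v0 (H_ser m 0) = N * (x_ser m - 1)"
    using H_ser_0_set_v0[of m] by (simp only: u_def Z_def N_def)
  have "u * Z * ((x_ser m - 1) * H') = (x_ser m - 1) * (u * Z * H')" by (simp only: mult_ac)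
  also have "\<dots> = (N * (x_ser m - 1)) * (H - H0)" unfolding key by (simp only: mult_ac)
  also have "\<dots> = u * Z * ((H - H0) * set_v0 (H_ser m 0))" unfolding ev[symmetric] by (simp only: mult_ac)
  finally show ?thesis
    using nonzero_series by (simp add: u_def Z_def H'_def H_def H0_def)
qed

text \<open>Polymorphic because it is used over the polynomial ring and over its fraction
  field.\<close>

definition t_ser :: "nat \<Rightarrow> 'a :: comm_ring_1 fps" where
  "t_ser m = fps_X * (1 - fps_X) ^ (m\<^sup>2 + 2 * m)"


lemma H_ser_closing:
  "H_ser m 0 = x_ser m + (x_ser m * y_ser m) * t_ser m * H_ser m m"
proof -
  define z :: poly_series where "z = fps_X"
  define N where "N = in_u N_ser"
  define M where "M = in_v N_ser"
  define u where "u = u_ser"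
  define v where "v = v_ser"
  define e where "e = 1 - z * u * v"
  define Z where "Z = (1 - z) ^ (m + 2)"
  define Y where "Y = (1 + z * v) ^ (m + 2)"
  define L where "L = (1 + z * u) ^ (m + 2)"
  define x where "x = x_ser m"
  define y where "y = y_ser m"
  define X where "X = in_u (X_ser m m)"
  define V where "V = in_v (X_ser m m)"
  define H where "H = H_ser m 0"
  define H' where "H' = H_ser m m"
  have Z1: "(1 - z) ^ ((m + 2) * (0 + 1)) = Z" by (simp add: Z_def)
  \<comment> \<open>The origin of the exponent in \<open>t\<close>: the \<open>m\<close> shifts cost
    \<open>m (m + 2)\<close> powers of \<open>1 - z\<close>.\<close>
  have Z2: "(1 - z) ^ ((m + 2) * (m + 1)) = Z * (1 - z) ^ (m\<^sup>2 + 2 * m)"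
  proof -
    have "(m + 2) * (m + 1) = (m + 2) + (m\<^sup>2 + 2 * m)" by (simp add: power2_eq_square)
    then show ?thesis unfolding Z_def by (simp only: power_add)
  qed
  have h: "(u - v) * e * Z * H = N * Y * (x - y)"
    using H_ser[of m 0]
    by (simp only: z_def[symmetric] Z1) (simp only: z_def N_def u_def v_def e_def Y_def x_def y_def x_ser_def y_ser_def H_def)
  have h': "(u - v) * e * (Z * (1 - z) ^ (m\<^sup>2 + 2 * m)) * H' = N * Y * (X - V)"
    using H_ser[of m m]
    by (simp only: z_def[symmetric] Z2) (simp only: z_def N_def u_def v_def e_def Y_def X_def V_def H'_def)
  have xL: "x * L = N"
    using x_ser[of m] unfolding in_u_N N_def L_def x_def u_def z_def by (simp add: mult_ac)
  have yY: "y * Y = M"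
    using y_ser[of m] unfolding in_v_N M_def Y_def y_def v_def z_def by (simp add: mult_ac)
  from X_ser_last[of m] obtain C where C: "at0 C = C"
    "fps_X * N_ser * X_ser m m + (1 + fps_X * w_ser) ^ (m + 2) + (1 - fps_X) ^ (m + 2) * w_ser = C * N_ser"
    by blast
  \<comment> \<open>\<open>C\<close> is free of \<open>w\<close>, so it becomes the same series for
    \<open>u\<close> and for \<open>v\<close>.\<close>
  have CC: "in_v C = in_u C" using in_u_in_v_simps(5)[of C] C(1) by simp
  have c: "z * N * X + L + Z * u = in_u C * N"
    using arg_cong[OF C(2), of in_u]
    by (simp only: in_u.hom_mult in_u.hom_diff in_u.hom_add in_u.hom_one in_u.hom_power series_morphisms
        in_u_X z_def N_def X_def L_def Z_def u_def)
  have c': "z * M * V + Y + Z * v = in_u C * M"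
    using arg_cong[OF C(2), of in_v]
    by (simp only: in_u.hom_mult in_u.hom_diff in_u.hom_add in_u.hom_one in_u.hom_power series_morphisms
        swap_uv.hom_mult swap_uv.hom_diff swap_uv.hom_add swap_uv.hom_one swap_uv.hom_power
        in_u_X z_def M_def V_def Y_def Z_def v_def CC)
  have nd: "N * v - M * u = - ((u - v) * e)"
    using N_diff by (simp only: N_def M_def u_def v_def e_def z_def)
  have nz: "(u - v) * e * Z \<noteq> 0"
    using nonzero_series by (simp add: u_def v_def e_def Z_def z_def)
  have "H = x + (x * y) * (z * (1 - z) ^ (m\<^sup>2 + 2 * m)) * H'"
    by (rule closing_algebra[OF h h' xL yY c c' nd nz])
  then show ?thesis by (simp only: H_def H'_def x_def y_def z_def t_ser_def)
qed

section \<open>The functional equation and its solution\<close>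

lemma (in ring_morphism) hom_weight: "h (weight m k x y n) = weight m k (h x) (h y) n"
  by (simp add: weight_def case_prod_unfold)

lemma x_ser_nth_0: "fps_nth (x_ser m) 0 = 1 + var1"
  using arg_cong[OF x_ser[of m], of "\<lambda>F. fps_nth F 0"] by (simp add: fps_nth_power_0)

lemma t_ser_nth_0: "fps_nth (t_ser m) 0 = 0"
  by (simp add: t_ser_def)

lemma t_ser_nth_1: "fps_nth (t_ser m) 1 = 1"
  by (simp add: t_ser_def fps_nth_power_0)

lemma map_fps_t_ser:
  assumes "ring_morphism h"
  shows "map_fps h (t_ser m) = t_ser m"
proof -
  interpret h: ring_morphism h by fact
  interpret H: ring_morphism "map_fps h" by (rule ring_morphism_map_fps) fact
  show ?thesis
    by (simp only: t_ser_def H.hom_mult H.hom_power H.hom_diff H.hom_one map_fps_X h.hom_zero h.hom_one)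
qed

lemma map_fps_subst_weight:
  assumes "ring_morphism h"
  shows "map_fps h (fps_subst (t_ser m) (weight m k x y)) =
    fps_subst (t_ser m) (weight m k (map_fps h x) (map_fps h y))"
  using map_fps_subst[OF assms, of "t_ser m" "weight m k x y"]
  by (simp only: map_fps_t_ser[OF assms] ring_morphism.hom_weight[OF ring_morphism_map_fps[OF assms]])

lemma fps_subst_weight_step:
  assumes "m \<ge> 1"
  shows "(x - 1) * fps_subst (t_ser m) (weight m (Suc k) x y) =
    (fps_subst (t_ser m) (weight m k x y) - fps_subst (t_ser m) (weight m k 1 y)) *
    fps_subst (t_ser m) (weight m 0 x 1)"
  unfolding fps_subst_diff[OF t_ser_nth_0, symmetric] fps_subst_mult[OF t_ser_nth_0]
    weight_Suc[OF assms, symmetric] fps_subst_mult_left[OF t_ser_nth_0] ..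

lemma fps_subst_weight_closing:
  assumes "m \<ge> 1"
  shows "fps_subst (t_ser m) (weight m 0 x y) =
    x + (x * y) * t_ser m * fps_subst (t_ser m) (weight m m x y)"
  by (subst fps_subst_Suc[OF t_ser_nth_0])
    (simp add: weight_0[OF assms] fps_subst_mult_left[OF t_ser_nth_0] mult_ac)

text \<open>Both families solve the same catalytic system, with \<open>set_u0\<close> for
  \<open>x = 1\<close> and \<open>set_v0\<close> for \<open>y = 1\<close>. The coefficient
  \<open>x - 1\<close> has the nonzero constant term \<open>u\<close>.\<close>

lemma fps_subst_weight_eq_H_ser:
  assumes "m \<ge> 1"
  shows "fps_subst (t_ser m) (weight m k (x_ser m) (y_ser m)) = H_ser m k"
proof (rule catalytic_system_unique[where t = "t_ser m" and c = "x_ser m - 1" and p = "x_ser m"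
      and q = "x_ser m * y_ser m" and m = m and e = "eval2 const2 0 var2" and f = "eval2 const2 var1 0"
      and A = "\<lambda>k. fps_subst (t_ser m) (weight m k (x_ser m) (y_ser m))" and B = "H_ser m"])
  show "fps_nth (x_ser m - 1) 0 \<noteq> 0" by (simp add: x_ser_nth_0)
  show "(x_ser m - 1) * fps_subst (t_ser m) (weight m (Suc k) (x_ser m) (y_ser m)) =
     (fps_subst (t_ser m) (weight m k (x_ser m) (y_ser m)) -
      set_u0 (fps_subst (t_ser m) (weight m k (x_ser m) (y_ser m)))) *
     set_v0 (fps_subst (t_ser m) (weight m 0 (x_ser m) (y_ser m)))" for k
    unfolding map_fps_subst_weight[OF ring_morphism_eval2_const2] set_x_ser
    by (rule fps_subst_weight_step[OF assms])
qed (rule t_ser_nth_0 fps_subst_weight_closing[OF assms] H_ser_step H_ser_closing)+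

section \<open>The product formula and its symmetry\<close>

lemma H_ser_0:
  "(u_ser - v_ser) * (1 - fps_X * u_ser * v_ser) * (1 - fps_X) ^ (m + 2) * H_ser m 0 =
   (1 + u_ser) * (1 + fps_X * u_ser) * (1 + fps_X * v_ser) ^ (m + 2) * (x_ser m - y_ser m)"
  using H_ser[of m 0] by (simp only: x_ser_def y_ser_def in_u_N add_0_left mult_1_right)

lemma H_ser_0_times_y:
  "(u_ser - v_ser) * (1 - fps_X * u_ser * v_ser) * (1 - fps_X) ^ (m + 2) * (y_ser m * H_ser m 0) =
   (1 + u_ser) * (1 + fps_X * u_ser) * (1 + v_ser) * (1 + fps_X * v_ser) * (x_ser m - y_ser m)"
proof -
  have y: "y_ser m * (1 + fps_X * v_ser) ^ (m + 2) = (1 + v_ser) * (1 + fps_X * v_ser)"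
    using y_ser[of m] by (simp add: mult_ac)
  have "a * (y_ser m * H_ser m 0) = y_ser m * (a * H_ser m 0)" for a by (simp only: mult_ac)
  then have "(u_ser - v_ser) * (1 - fps_X * u_ser * v_ser) * (1 - fps_X) ^ (m + 2) * (y_ser m * H_ser m 0) =
    (1 + u_ser) * (1 + fps_X * u_ser) * (y_ser m * (1 + fps_X * v_ser) ^ (m + 2)) * (x_ser m - y_ser m)"
    by (simp only: H_ser_0) (simp only: mult_ac)
  then show ?thesis unfolding y by (simp only: mult_ac)
qed

text \<open>Exchanging \<open>u\<close> and \<open>v\<close> changes the sign of both
  \<open>u - v\<close> and \<open>x - y\<close>; all else in \<open>H_ser_0_times_y\<close> is
  symmetric.\<close>

lemma swap_y_H_ser: "swap_uv (y_ser m * H_ser m 0) = y_ser m * H_ser m 0"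
proof -
  let ?c = "(u_ser - v_ser) * (1 - fps_X * u_ser * v_ser) * (1 - fps_X) ^ (m + 2)"
  have "(v_ser - u_ser) * (1 - fps_X * v_ser * u_ser) * (1 - fps_X) ^ (m + 2) * swap_uv (y_ser m * H_ser m 0) =
   (1 + v_ser) * (1 + fps_X * v_ser) * (1 + u_ser) * (1 + fps_X * u_ser) * (y_ser m - x_ser m)"
    using arg_cong[OF H_ser_0_times_y[of m], of swap_uv]
    by (simp only: swap_uv.hom_mult swap_uv.hom_diff swap_uv.hom_add swap_uv.hom_one swap_uv.hom_power
        series_morphisms swap_x_ser)
  moreover have "(v - u) * (1 - z * v * u) * Z * S = (1 + v) * (1 + z * v) * (1 + u) * (1 + z * u) * (y - x) \<Longrightarrow>
      (u - v) * (1 - z * u * v) * Z * S = (1 + u) * (1 + z * u) * (1 + v) * (1 + z * v) * (x - y)"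
    for u v z Z S x y :: poly_series
    by algebra
  ultimately have "?c * swap_uv (y_ser m * H_ser m 0) =
    (1 + u_ser) * (1 + fps_X * u_ser) * (1 + v_ser) * (1 + fps_X * v_ser) * (x_ser m - y_ser m)"
    by blast
  then have "?c * swap_uv (y_ser m * H_ser m 0) = ?c * (y_ser m * H_ser m 0)"
    by (simp only: H_ser_0_times_y)
  moreover have "?c \<noteq> 0" using nonzero_series by simp
  ultimately show ?thesis using mult_left_cancel by blast
qed

lemma ring_morphism_fps_const: "ring_morphism (fps_const :: 'a :: comm_ring_1 \<Rightarrow> 'a fps)"
  by unfold_locales simp_all

text \<open>The symmetry holds after the substitution, and the substitution is injective:
  \<open>t\<close> starts with \<open>z\<close>, while \<open>x\<close> and \<open>y\<close> start
  with \<open>1 + u\<close> and \<open>1 + v\<close>.\<close>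

lemma weight_symmetric:
  assumes "m \<ge> 1"
  shows "var2 * weight m 0 var1 var2 n = var1 * weight m 0 var2 var1 n"
proof -
  define D where "D n = var2 * weight m 0 var1 var2 n - var1 * weight m 0 var2 var1 n" for n
  define ev where "ev = eval2 (\<lambda>c. fps_const (const2 c)) (x_ser m) (y_ser m)"
  have const: "ring_morphism (\<lambda>c. fps_const (const2 c))"
    by (rule ring_morphism_comp[OF ring_morphism_fps_const ring_morphism_const2])
  interpret ev: ring_morphism ev
    unfolding ev_def by (rule ring_morphism_eval2[OF const])
  have ev_vars: "ev var1 = x_ser m" "ev var2 = y_ser m"
    by (simp_all add: ev_def eval2_simps[OF const])
  have "swap_uv (fps_subst (t_ser m) (weight m 0 (x_ser m) (y_ser m))) =
      fps_subst (t_ser m) (weight m 0 (y_ser m) (x_ser m))"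
    by (simp only: map_fps_subst_weight[OF ring_morphism_eval2_const2] swap_x_ser)
  with swap_y_H_ser[of m]
  have "x_ser m * fps_subst (t_ser m) (weight m 0 (y_ser m) (x_ser m)) =
      y_ser m * fps_subst (t_ser m) (weight m 0 (x_ser m) (y_ser m))"
    by (simp only: swap_uv.hom_mult swap_x_ser fps_subst_weight_eq_H_ser[OF assms])
  then have subst0: "fps_subst (t_ser m) (\<lambda>n. ev (D n)) = 0"
    by (simp only: D_def ev.hom_diff ev.hom_mult ev.hom_weight ev_vars fps_subst_diff[OF t_ser_nth_0]
        fps_subst_mult_left[OF t_ser_nth_0] diff_self)
  \<comment> \<open>The constant term of \<open>ev p\<close> is \<open>p\<close> at
    \<open>1 + u\<close> and \<open>1 + v\<close>; translating both variables back by 1 recovers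
    \<open>p\<close>.\<close>
  have inj: "p = 0" if "fps_nth (ev p) 0 = 0" for p
  proof -
    have nth0: "ring_morphism (\<lambda>F :: poly_series. fps_nth F 0)"
      by unfold_locales simp_all
    have "fps_nth (ev p) 0 = eval2 const2 (1 + var1) (1 + var2) p"
    proof (rule ring_morphism_poly_poly_eqI[OF ring_morphism_comp[OF nth0 ev.ring_morphism_axioms]
          ring_morphism_eval2_const2])
      show "fps_nth (ev (const2 c)) 0 = eval2 const2 (1 + var1) (1 + var2) (const2 c)" for c
        by (simp add: ev_def eval2_simps[OF const])
      have "fps_nth (y_ser m) 0 = 1 + var2"
        using arg_cong[OF y_ser[of m], of "\<lambda>F. fps_nth F 0"] by (simp add: fps_nth_power_0)
      then show "fps_nth (ev var2) 0 = eval2 const2 (1 + var1) (1 + var2) var2"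
        by (simp only: ev_vars eval2_const2_simps)
      show "fps_nth (ev var1) 0 = eval2 const2 (1 + var1) (1 + var2) var1"
        by (simp only: ev_vars x_ser_nth_0 eval2_const2_simps)
    qed
    with that have 0: "eval2 const2 (1 + var1) (1 + var2) p = 0" by simp
    interpret shift: ring_morphism "eval2 const2 (var1 - 1) (var2 - 1)"
      by (rule ring_morphism_eval2_const2)
    have id: "ring_morphism (\<lambda>p :: rat poly poly. p)" by unfold_locales simp_all
    have "eval2 const2 (var1 - 1) (var2 - 1) (eval2 const2 (1 + var1) (1 + var2) p) = p"
      by (rule ring_morphism_poly_poly_eqI[OF ring_morphism_comp[OF shift.ring_morphism_axioms
            ring_morphism_eval2_const2] id])
        (simp_all only: eval2_const2_simps shift.hom_add shift.hom_one add_diff_cancel_left' diff_add_cancel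
          add.commute[of 1])
    with 0 show "p = 0" by (simp only: shift.hom_zero)
  qed
  have "ev (D n) = 0"
  proof (rule fps_subst_eq_0[OF t_ser_nth_0 t_ser_nth_1 subst0])
    show "ev (D k) = 0" if "fps_nth (ev (D k)) 0 = 0" for k
      using inj[OF that] by (simp only: ev.hom_zero)
  qed
  then have "D n = 0" using inj[of "D n"] by simp
  then show ?thesis by (simp add: D_def)
qed

lemma coeff_monomial:
  "coeff (coeff (var1 ^ a * var2 ^ b) j) i = (if i = a \<and> j = b then 1 else 0)"
proof -
  have "var1 ^ a = [:monom 1 a:]"
    by (simp add: poly_const_pow monom_altdef)
  moreover have "var2 ^ b = monom 1 b"
    by (simp add: monom_altdef)
  ultimately show ?thesis by (auto simp: smult_monom)
qed

text \<open>Exchanging the variables transposes the coefficients, which matches the form of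
  \<open>symmetric_series\<close>.\<close>

lemma coeff_weight_swap:
  "coeff (coeff (var2 * weight m 0 var1 var2 n) j) i = coeff (coeff (var1 * weight m 0 var2 var1 n) i) j"
proof -
  have "var2 * (var1 ^ a * var2 ^ b) = var1 ^ a * var2 ^ Suc b"
    "var1 * (var2 ^ a * var1 ^ b) = var1 ^ Suc b * var2 ^ a" for a b
    by (simp_all only: power_Suc mult_ac)
  then show ?thesis
    by (auto simp: weight_def sum_distrib_left case_prod_unfold coeff_sum coeff_monomial
        simp del: power_Suc intro!: sum.cong)
qed

lemma ring_morphism_to_fract: "ring_morphism (to_fract :: 'a :: idom \<Rightarrow> 'a fract)"
  by unfold_locales simp_all

theorem theorem3p1:
  fixes m :: nat and z u v t x y :: uv_series
  assumes "m \<ge> 1"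
    and "z = fps_X" and "u = uv_const var1" and "v = uv_const var2"
    and "t = z * (1 - z) ^ (m\<^sup>2 + 2 * m)"
    and "x = (1 + u) / (1 + z * u) ^ (m + 1)"
    and "y = (1 + v) / (1 + z * v) ^ (m + 1)"
  shows "(\<exists>G. substitutes_to (tamari_gf m) t x y G \<and> polynomial_coeffs G \<and> rational_series G \<and>
            y * G = (1 + u) * (1 + z * u) * (1 + v) * (1 + z * v)
                      / ((u - v) * (1 - z * u * v) * (1 - z) ^ (m + 2))
                    * ((1 + u) / (1 + z * u) ^ (m + 1) - (1 + v) / (1 + z * v) ^ (m + 1))) \<and>
         symmetric_series (fps_const var2 * tamari_gf m)"
proof -
  \<comment> \<open>All identities so far have coefficients in Q[u,v]; \<open>emb\<close> carries
    them to Q(u,v), and its values have polynomial coefficients by construction.\<close>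
  define emb :: "poly_series \<Rightarrow> uv_series" where "emb = map_fps to_fract"
  interpret emb: ring_morphism emb
    unfolding emb_def by (rule ring_morphism_map_fps[OF ring_morphism_to_fract])
  have emb_simps: "emb fps_X = z" "emb u_ser = u" "emb v_ser = v"
    by (simp_all add: emb_def assms(2-4))
  have nz: "F \<noteq> 0" if "fps_nth F 0 \<noteq> 0" for F :: uv_series
    using that by auto
  have "(1 + z * u) ^ (m + 1) \<noteq> 0" "(1 + z * v) ^ (m + 1) \<noteq> 0"
    by (rule nz; simp add: assms(2) fps_nth_power_0)+
  moreover have "emb (x_ser m) * (1 + z * u) ^ (m + 1) = 1 + u"
    "emb (y_ser m) * (1 + z * v) ^ (m + 1) = 1 + v"
    using arg_cong[OF x_ser[of m], of emb] arg_cong[OF y_ser[of m], of emb]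
    by (simp_all only: emb.hom_mult emb.hom_add emb.hom_one emb.hom_power emb_simps)
  ultimately have x: "x = emb (x_ser m)" and y: "y = emb (y_ser m)"
    using assms(6,7) by (metis nonzero_mult_div_cancel_right)+
  have t: "t = t_ser m" by (simp add: t_ser_def assms(2,5))
  have const: "ring_morphism (\<lambda>c. uv_const (const2 c))"
    by (rule ring_morphism_comp[OF ring_morphism_comp[OF ring_morphism_fps_const
            ring_morphism_to_fract] ring_morphism_const2])
  define G where "G = emb (H_ser m 0)"
  have "substitutes_to (tamari_gf m) t x y G"
  proof -
    have "eval_xy (fps_nth (tamari_gf m) n) x y = weight m 0 x y n" for n
    proof -
      have "eval_xy p x y = eval2 (\<lambda>c. uv_const (const2 c)) x y p" for p
        by (simp add: eval_xy_def eval2_def)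
      then show ?thesis
        by (simp only: tamari_gf_nth[OF assms(1)] eval2_simps[OF const]
            ring_morphism.hom_weight[OF ring_morphism_eval2[OF const]])
    qed
    moreover have "G = fps_subst t (weight m 0 x y)"
      by (simp only: G_def t x y emb_def fps_subst_weight_eq_H_ser[OF assms(1), symmetric]
          map_fps_subst_weight[OF ring_morphism_to_fract])
    ultimately show ?thesis
      unfolding substitutes_to_def using fps_subst_sums[of t "weight m 0 x y"]
      by (simp add: t t_ser_nth_0)
  qed
  moreover have "polynomial_coeffs G"
    by (simp add: polynomial_coeffs_def G_def emb_def)
  moreover have "rational_series G"
  proof -
    let ?z = "[:0, 1:] :: rat poly poly poly" and ?u = "[:var1:]" and ?v = "[:var2:]"
    \<comment> \<open>The factor \<open>(1 + z v)^(m + 2)\<close> in \<open>H_ser_0\<close> already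
      clears the denominator of \<open>y\<close>; the last factor of \<open>B\<close> clears that of
      \<open>x\<close>.\<close>
    define B where "B = (?u - ?v) * (1 - ?z * ?u * ?v) * (1 - ?z) ^ (m + 2) * (1 + ?z * ?u) ^ (m + 1)"
    define A where "A = (1 + ?u) * (1 + ?z * ?u) *
      ((1 + ?u) * (1 + ?z * ?v) ^ (m + 2) - (1 + ?z * ?u) ^ (m + 1) * (1 + ?v) * (1 + ?z * ?v))"
    have pz: "fps_of_poly ?z = fps_X" "fps_of_poly ?u = u_ser" "fps_of_poly ?v = v_ser"
      by (rule fps_of_poly_fps_X fps_of_poly_const)+
    have B: "fps_of_poly B = (u_ser - v_ser) * (1 - fps_X * u_ser * v_ser) * (1 - fps_X) ^ (m + 2) *
        (1 + fps_X * u_ser) ^ (m + 1)"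
      unfolding B_def by (simp only: fps_of_poly_mult fps_of_poly_diff fps_of_poly_add fps_of_poly_1
          fps_of_poly_power pz)
    have A: "fps_of_poly A = (1 + u_ser) * (1 + fps_X * u_ser) * ((1 + u_ser) * (1 + fps_X * v_ser) ^ (m + 2) -
        (1 + fps_X * u_ser) ^ (m + 1) * (1 + v_ser) * (1 + fps_X * v_ser))"
      unfolding A_def by (simp only: fps_of_poly_mult fps_of_poly_diff fps_of_poly_add fps_of_poly_1
          fps_of_poly_power pz)
    have y': "y_ser m * (1 + fps_X * v_ser) ^ (m + 2) = (1 + v_ser) * (1 + fps_X * v_ser)"
      using y_ser[of m] by (simp add: mult_ac)
    have rat: "H * (c * L) = N * (a * Y - L * b * w)"
      if "c * H = N * Y * (x - y)" "x * L = a" "y * Y = b * w" for c H N Y x y L a b w :: poly_series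
      using that by algebra
    have "H_ser m 0 * fps_of_poly B = fps_of_poly A"
      unfolding A B
      by (rule rat[OF H_ser_0 x_ser y'])
    moreover have "emb (fps_of_poly p) = fps_of_poly (map_poly to_fract p)" for p
      by (rule fps_ext) (simp add: emb_def coeff_map_poly)
    ultimately have "G * fps_of_poly (map_poly to_fract B) = fps_of_poly (map_poly to_fract A)"
      by (metis G_def emb.hom_mult)
    moreover have "(1 + fps_X * u_ser) ^ (m + 1) \<noteq> 0"
      by (rule power_not_zero) (auto simp: fps_eq_iff intro!: exI[of _ 0])
    then have "fps_of_poly B \<noteq> 0"
      unfolding B using nonzero_series by simp
    then have "B \<noteq> 0" by auto
    ultimately show ?thesis unfolding rational_series_def by blast
  qed
  moreover have "y * G = (1 + u) * (1 + z * u) * (1 + v) * (1 + z * v)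
      / ((u - v) * (1 - z * u * v) * (1 - z) ^ (m + 2)) * (x - y)"
  proof -
    let ?P = "(u - v) * (1 - z * u * v) * (1 - z) ^ (m + 2)"
    let ?A = "(1 + u) * (1 + z * u) * (1 + v) * (1 + z * v)"
    \<comment> \<open>The constant term is \<open>u - v\<close>, a unit of Q(u,v), so the quotient
      of series by \<open>?P\<close> is exact.\<close>
    have P0: "fps_nth ?P 0 \<noteq> 0"
      by (simp add: assms(2-4) fps_nth_power_0 flip: to_fract_diff)
    then have "?A / ?P * ?P = ?A"
      by (intro dvd_div_mult_self) (simp add: fps_dvd_iff subdegree_eq_0)
    moreover have "?P * (y * G) = ?A * (x - y)"
      using arg_cong[OF H_ser_0_times_y[of m], of emb]
      by (simp only: emb.hom_mult emb.hom_diff emb.hom_add emb.hom_one emb.hom_power emb_simps G_def x y)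
    moreover have "y * G = a * (x - y)" if "P \<noteq> 0" "a * P = A" "P * (y * G) = A * (x - y)" for a P A
    proof -
      have "P * (y * G) = P * (a * (x - y))"
        unfolding that(3) that(2)[symmetric] by (simp only: mult_ac)
      then show ?thesis using mult_left_cancel[OF that(1)] by blast
    qed
    ultimately show ?thesis using nz[OF P0] by blast
  qed
  moreover have "symmetric_series (fps_const var2 * tamari_gf m)"
    unfolding symmetric_series_def fps_mult_left_const_nth tamari_gf_nth[OF assms(1)]
    by (intro allI, rule trans[OF coeff_weight_swap], simp only: weight_symmetric[OF assms(1)])
  ultimately show ?thesis unfolding assms(6,7)[symmetric] by blast
qed

end
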